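(* Every $\{P_6,\text{dart},K_4\}$-free graph $G$ is $6$-colorable, i.e. $\chi(G)\le 6$. Moreover, this bound is tight: there exists a $\{P_6,\text{dart},K_4\}$-free graph $G$ with $\chi(G)=6$.
   Context: All graphs are finite, simple and undirected. $P_6$ denotes the path on $6$ vertices and $K_4$ the complete graph on $4$ vertices. A diamond is the graph obtained from $K_4$ by removing an edge. A dart is the graph obtained from a diamond by adding a new vertex adjacent to exactly one vertex of the diamond, that vertex being one of degree $3$ in the diamond. A graph is $\{P_6,\text{dart},K_4\}$-free if it contains no induced subgraph isomorphic to $P_6$, to the dart, or to $K_4$. $\chi(G)$ denotes the chromatic number of $G$. *)

theory Defs
  imports "Graph_Theory.Graph_Theory"
begin

text \<open>
  Finite simple undirected graphs are the finite loop-free symmetric digraphs without parallel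
  arcs of the locale \<open>pair_graph\<close>: an edge \<open>uv\<close> is represented by the two arcs \<open>(u, v)\<close> and
  \<open>(v, u)\<close>. The null graph is allowed.
\<close>

definition contains_induced :: "'a pair_pre_digraph \<Rightarrow> 'b pair_pre_digraph \<Rightarrow> bool" where
  "contains_induced G H \<longleftrightarrow>
     (\<exists>G'. induced_subgraph G' (with_proj G) \<and> digraph_iso G' (with_proj H))"

definition graph_of_edges :: "'a set \<Rightarrow> 'a rel \<Rightarrow> 'a pair_pre_digraph" where
  "graph_of_edges V E = \<lparr> pverts = V, parcs = E \<union> E\<inverse> \<rparr>"

definition path_graph :: "nat \<Rightarrow> nat pair_pre_digraph" where
  "path_graph n = graph_of_edges {..<n} {(i, Suc i) | i. Suc i < n}"

definition complete_graph :: "nat \<Rightarrow> nat pair_pre_digraph" where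
  "complete_graph n = graph_of_edges {..<n} {(i, j). i < j \<and> j < n}"

text \<open>
  The diamond is \<open>K\<^sub>4\<close> on the vertices 0, 1, 2, 3 without the edge 23, so 0 and 1 are its vertices
  of degree 3. The dart has the additional vertex 4, adjacent to 0 only.
\<close>

definition diamond :: "nat pair_pre_digraph" where
  "diamond = \<lparr> pverts = pverts (complete_graph 4),
               parcs = parcs (complete_graph 4) - {(2, 3), (3, 2)} \<rparr>"

definition dart :: "nat pair_pre_digraph" where
  "dart = \<lparr> pverts = insert 4 (pverts diamond), parcs = parcs diamond \<union> {(0, 4), (4, 0)} \<rparr>"

definition P6_dart_K4_free :: "'a pair_pre_digraph \<Rightarrow> bool" where
  "P6_dart_K4_free G \<longleftrightarrow>
     \<not> contains_induced G (path_graph 6) \<and>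
     \<not> contains_induced G dart \<and>
     \<not> contains_induced G (complete_graph 4)"

definition proper_coloring :: "'a pair_pre_digraph \<Rightarrow> nat \<Rightarrow> ('a \<Rightarrow> nat) \<Rightarrow> bool" where
  "proper_coloring G k c \<longleftrightarrow>
     (\<forall>v \<in> pverts G. c v < k) \<and> (\<forall>(u, v) \<in> parcs G. c u \<noteq> c v)"

definition colorable :: "'a pair_pre_digraph \<Rightarrow> nat \<Rightarrow> bool" where
  "colorable G k \<longleftrightarrow> (\<exists>c. proper_coloring G k c)"

definition chromatic_number :: "'a pair_pre_digraph \<Rightarrow> nat" where
  "chromatic_number G = (LEAST k. colorable G k)"

lemma colorable_card:
  assumes "pair_graph G"
  shows "colorable G (card (pverts G))"
proof -
  interpret pair_graph G by fact
  obtain c where c: "bij_betw c (pverts G) {0..<card (pverts G)}"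
    using ex_bij_betw_finite_nat[OF pair_finite_verts] by blast
  have "c u \<noteq> c v" if "(u, v) \<in> parcs G" for u v
    using that in_arcsD1[OF that] in_arcsD2[OF that] pair_no_loops[OF that] c
    by (auto simp: bij_betw_def inj_on_def)
  moreover have "c v < card (pverts G)" if "v \<in> pverts G" for v
    using bij_betwE[OF c] that by auto
  ultimately show ?thesis
    unfolding colorable_def proper_coloring_def by blast
qed

lemma chromatic_number_le_iff:
  assumes "pair_graph G"
  shows "chromatic_number G \<le> k \<longleftrightarrow> colorable G k"
proof
  assume le: "chromatic_number G \<le> k"
  have "colorable G (chromatic_number G)"
    unfolding chromatic_number_def by (rule LeastI[where P = "colorable G", OF colorable_card[OF assms]])
  then show "colorable G k"
    using le unfolding colorable_def proper_coloring_def by (meson order_less_le_trans)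
next
  assume "colorable G k"
  then show "chromatic_number G \<le> k"
    unfolding chromatic_number_def by (rule Least_le)
qed

lemma complete_digraph_complete_graph: "complete_digraph n (with_proj (complete_graph n))"
  unfolding complete_digraph_pair_def
  by (auto simp: complete_graph_def graph_of_edges_def)

lemma dart_explicit:
  "dart = graph_of_edges {0, 1, 2, 3, 4} {(0, 1), (0, 2), (0, 3), (1, 2), (1, 3), (0, 4)}"
proof -
  have V: "{..<4::nat} = {0, 1, 2, 3}" by (simp add: numeral_eq_Suc lessThan_Suc insert_commute)
  have lt4: "i < j \<and> j < 4 \<longleftrightarrow>
      (i, j) \<in> {(0, 1), (0, 2), (0, 3), (1, 2), (1, 3), (2, 3)}" for i j :: nat
    by (simp only: insert_iff empty_iff prod.inject) presburger
  have E: "{(i, j). i < j \<and> j < (4::nat)} = {(0, 1), (0, 2), (0, 3), (1, 2), (1, 3), (2, 3)}"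
    unfolding lt4 by (simp only: case_prod_eta[of "\<lambda>x. x \<in> _"] Collect_mem_eq)
  have conv: "(insert (a, b) R)\<inverse> = insert (b, a) (R\<inverse>)" for a b :: nat and R
    by auto
  show ?thesis
    unfolding dart_def diamond_def complete_graph_def graph_of_edges_def V E
      pair_pre_digraph.simps pair_pre_digraph.ext_inject
    by (intro conjI equalityI) (simp_all add: conv insert_Diff_if)
qed

lemma contains_induced_iff:
  assumes "pair_wf_digraph G" "pair_wf_digraph H"
  shows "contains_induced G H \<longleftrightarrow>
    (\<exists>f. inj_on f (pverts H) \<and> f ` pverts H \<subseteq> pverts G \<and>
         (\<forall>u \<in> pverts H. \<forall>v \<in> pverts H. (f u, f v) \<in> parcs G \<longleftrightarrow> (u, v) \<in> parcs H))"
    (is "_ \<longleftrightarrow> (\<exists>f. ?emb f)")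
proof
  assume "contains_induced G H"
  then obtain G' h where ind: "induced_subgraph G' (with_proj G)"
    and h: "pre_digraph.digraph_isomorphism G' h" and H: "with_proj H = app_iso h G'"
    unfolding contains_induced_def digraph_iso_def by blast
  let ?h = "iso_verts h" and ?a = "iso_arcs h"
  have V: "verts G' \<subseteq> pverts G" and T: "tail G' = fst" "head G' = snd"
    and A: "arcs G' = {e \<in> parcs G. fst e \<in> verts G' \<and> snd e \<in> verts G'}"
    using ind by (simp_all add: induced_subgraph_def subgraph_def compatible_def)
  have VH: "pverts H = ?h ` verts G'" and AH: "parcs H = ?a ` arcs G'"
    and TH: "iso_tail h = fst" "iso_head h = snd"
    using H by (simp_all add: app_iso_def with_proj_def)
  have inj: "inj_on ?h (verts G')"
    and ends: "\<And>e. e \<in> arcs G' \<Longrightarrow> ?a e = (?h (fst e), ?h (snd e))"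
    using h unfolding pre_digraph.digraph_isomorphism_def T TH by (simp_all add: prod_eq_iff)
  let ?f = "the_inv_into (verts G') ?h"
  have f: "?f (?h v) = v" if "v \<in> verts G'" for v
    using the_inv_into_f_f[OF inj that] .
  have arcs_iff: "(?h u, ?h v) \<in> parcs H \<longleftrightarrow> (u, v) \<in> parcs G"
    if uv: "u \<in> verts G'" "v \<in> verts G'" for u v
  proof
    assume "(?h u, ?h v) \<in> parcs H"
    then obtain e where e: "e \<in> arcs G'" "(?h u, ?h v) = ?a e"
      unfolding AH by blast
    have "?h (fst e) = ?h u" "?h (snd e) = ?h v"
      using e(2) unfolding ends[OF e(1)] by simp_all
    moreover have "fst e \<in> verts G'" "snd e \<in> verts G'" and eG: "e \<in> parcs G"
      using e(1) unfolding A by simp_all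
    ultimately have "e = (u, v)"
      using inj_onD[OF inj] uv by (metis prod.collapse)
    then show "(u, v) \<in> parcs G"
      using eG by simp
  next
    assume "(u, v) \<in> parcs G"
    then have "(u, v) \<in> arcs G'"
      unfolding A using uv by simp
    then show "(?h u, ?h v) \<in> parcs H"
      unfolding AH using ends[of "(u, v)"] by (metis fst_conv imageI snd_conv)
  qed
  have "inj_on ?f (pverts H)"
    unfolding VH using f by (auto intro!: inj_on_inverseI[where g = ?h])
  moreover have "?f ` pverts H \<subseteq> pverts G"
    unfolding VH using V f by auto
  moreover have "\<forall>u \<in> pverts H. \<forall>v \<in> pverts H. (?f u, ?f v) \<in> parcs G \<longleftrightarrow> (u, v) \<in> parcs H"
    unfolding VH by (simp add: f arcs_iff)
  ultimately have "?emb ?f" by blast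
  then show "\<exists>f. ?emb f" by (rule exI[of _ ?f])
next
  assume "\<exists>f. ?emb f"
  then obtain f where inj: "inj_on f (pverts H)" and V: "f ` pverts H \<subseteq> pverts G"
    and arcs_iff: "\<And>u v. u \<in> pverts H \<Longrightarrow> v \<in> pverts H \<Longrightarrow>
      (f u, f v) \<in> parcs G \<longleftrightarrow> (u, v) \<in> parcs H"
    by blast
  interpret G: pair_wf_digraph G by fact
  interpret H: pair_wf_digraph H by fact
  let ?G' = "with_proj G \<restriction> f ` pverts H"
  define g where "g = the_inv_into (pverts H) f"
  define h where "h = \<lparr> iso_verts = g, iso_arcs = (\<lambda>(u, v). (g u, g v)),
    iso_head = snd, iso_tail = fst \<rparr>"
  have g: "g (f v) = v" if "v \<in> pverts H" for v
    unfolding g_def using the_inv_into_f_f[OF inj that] .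
  have ga: "(\<lambda>(u, v). (g u, g v)) ((\<lambda>(u, v). (f u, f v)) e) = e" if "e \<in> parcs H" for e
    using that g H.in_arcsD1 H.in_arcsD2 by (cases e) simp
  have ind: "induced_subgraph ?G' (with_proj G)"
    using G.induced_induce[of "f ` pverts H"] V by simp
  then have wf: "wf_digraph ?G'"
    by (simp add: induced_subgraph_def subgraph_def)
  have A: "arcs ?G' = (\<lambda>(u, v). (f u, f v)) ` parcs H"
  proof (intro equalityI subsetI)
    fix e assume "e \<in> arcs ?G'"
    then obtain u v where "e = (f u, f v)" "u \<in> pverts H" "v \<in> pverts H" "e \<in> parcs G"
      by (cases e) (auto simp: induce_subgraph_def)
    then show "e \<in> (\<lambda>(u, v). (f u, f v)) ` parcs H"
      using arcs_iff by (intro image_eqI[of _ _ "(u, v)"]) auto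
  next
    fix e assume "e \<in> (\<lambda>(u, v). (f u, f v)) ` parcs H"
    then show "e \<in> arcs ?G'"
      using arcs_iff H.in_arcsD1 H.in_arcsD2 by (auto simp: induce_subgraph_def)
  qed
  have "inj_on g (f ` pverts H)"
    using g by (auto intro!: inj_on_inverseI[where g = f])
  moreover have "inj_on (\<lambda>(u, v). (g u, g v)) ((\<lambda>(u, v). (f u, f v)) ` parcs H)"
    by (rule inj_on_inverseI[where g = "\<lambda>(u, v). (f u, f v)"]) (use ga in fastforce)
  ultimately have "pre_digraph.digraph_isomorphism ?G' h"
    unfolding pre_digraph.digraph_isomorphism_def A
    using wf by (auto simp: h_def induce_subgraph_def)
  moreover have "with_proj H = app_iso h ?G'"
  proof -
    have "g ` f ` pverts H = pverts H"
      unfolding image_image using g by (simp cong: image_cong)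
    moreover have "(\<lambda>(u, v). (g u, g v)) ` (\<lambda>(u, v). (f u, f v)) ` parcs H = parcs H"
      unfolding image_image using ga by (simp cong: image_cong)
    ultimately show ?thesis
      unfolding app_iso_def A by (simp add: h_def with_proj_def induce_subgraph_def)
  qed
  ultimately show "contains_induced G H"
    using ind unfolding contains_induced_def digraph_iso_def by blast
qed

end

(* Upper bound. In a minimal graph that is not 6-colorable all degrees are at least 6 and no vertex
dominates a non-adjacent one; with dart-freeness this forces an edge in two triangles to join two
twins. Let T = {x, y, z} be a triangle and M the set of vertices without a neighbour in T. Since an
attachment vertex of a component Q of M ends an induced P3 whose other vertices do not see M,
P6-freeness leaves only shallow components, and M is 3-colorable; the same argument with an edge in
place of T settles the graphs with twins and the triangle-free ones. Otherwise the graph is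
diamond-free, and the neighbours of T fall into three rows, each inducing a matching. If M has an
edge, then vertices of different rows that attach to it differently are adjacent; as adjacent vertices
have at most one common neighbour, this rigidity makes the rows 3-colorable, or M bipartite and
the rows 4-colorable. If M is independent, 2-color each row; a vertex of M that sees all six colors
yields, by P6-freeness again, a partition into five independent sets.

Tightness. The complement of the Schlaefli graph is the collinearity graph of the generalized
quadrangle GQ(2,4). Each of its edges lies in a unique triangle, and that triangle is dominating, which
excludes P6, the dart and K4. That five colors do not suffice is a propositional refutation. *)

theory Submission
  imports Defs
begin

section \<open>Colorings of vertex sets\<close>


text \<open>Colors are budgeted against six. A triangle and its \<open>M\<close> share three colors,
  so a 3-coloring of the rows would suffice. Once \<open>M\<close> is bipartite, two triangle
  vertices fit into its two colors, and the rows have four left, provided they also absorb the third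
  triangle vertex. Most steps therefore aim at an independent set, and usually get it in the same
  way: if an edge has at most one common neighbour, a set whose members all see the same two
  vertices is independent. The two vertices come from cut arguments: too few attachments in front of
  a set that needs few colors would let a coloring extend. The adjacencies come from P6-freeness:
  two vertices of different rows that see an edge of \<open>M\<close> differently, neither seeing
  both ends, are adjacent. Edges in two triangles spoil this reasoning, hence they are eliminated
  before the rows are studied.\<close>

locale sgraph =
  fixes V :: "'a set" and E :: "'a \<Rightarrow> 'a \<Rightarrow> bool"
  assumes finV: "finite V"
    and symE: "E u v \<Longrightarrow> E v u"
    and irrE: "\<not> E u u"
    and inV: "E u v \<Longrightarrow> u \<in> V"
begin

lemma inV2: "E u v \<Longrightarrow> v \<in> V"
  using symE inV by blast

lemma E_commute: "E u v \<longleftrightarrow> E v u"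
  using symE by blast

definition indep :: "'a set \<Rightarrow> bool" where
  "indep A \<longleftrightarrow> (\<forall>u\<in>A. \<forall>v\<in>A. \<not> E u v)"

definition col :: "'a set \<Rightarrow> nat \<Rightarrow> bool" where
  "col A k \<longleftrightarrow> (\<exists>c::'a \<Rightarrow> nat. (\<forall>v\<in>A. c v < k) \<and> (\<forall>u\<in>A. \<forall>v\<in>A. E u v \<longrightarrow> c u \<noteq> c v))"

lemma indepI: "(\<And>u v. u \<in> A \<Longrightarrow> v \<in> A \<Longrightarrow> E u v \<Longrightarrow> False) \<Longrightarrow> indep A"
  unfolding indep_def by blast

lemma indepD: "indep A \<Longrightarrow> u \<in> A \<Longrightarrow> v \<in> A \<Longrightarrow> E u v \<Longrightarrow> False"
  unfolding indep_def by blast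

lemma indep_subset: "indep A \<Longrightarrow> B \<subseteq> A \<Longrightarrow> indep B"
  unfolding indep_def by blast

lemma colI:
  fixes c :: "'a \<Rightarrow> nat"
  assumes "\<And>v. v \<in> A \<Longrightarrow> c v < k" "\<And>u v. u \<in> A \<Longrightarrow> v \<in> A \<Longrightarrow> E u v \<Longrightarrow> c u \<noteq> c v"
  shows "col A k"
  unfolding col_def using assms by blast

lemma colE:
  assumes "col A k"
  obtains c :: "'a \<Rightarrow> nat" where "\<And>v. v \<in> A \<Longrightarrow> c v < k"
    "\<And>u v. u \<in> A \<Longrightarrow> v \<in> A \<Longrightarrow> E u v \<Longrightarrow> c u \<noteq> c v"
  using assms unfolding col_def by blast

lemma col_mono: "col A k \<Longrightarrow> B \<subseteq> A \<Longrightarrow> k \<le> l \<Longrightarrow> col B l"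
proof -
  assume a: "col A k" "B \<subseteq> A" "k \<le> l"
  then obtain c where c: "\<forall>v\<in>A. c v < k" "\<forall>u\<in>A. \<forall>v\<in>A. E u v \<longrightarrow> c u \<noteq> c v"
    unfolding col_def by blast
  show ?thesis
  proof (rule colI[where c = c])
    show "c v < l" if "v \<in> B" for v
      using a(2,3) c(1) that by (meson order_less_le_trans subsetD)
    show "c u \<noteq> c v" if "u \<in> B" "v \<in> B" "E u v" for u v
      using a(2) c(2) that by blast
  qed
qed

lemma col_indep: "indep A \<Longrightarrow> col A 1"
  by (rule colI[where c = "\<lambda>_. 0"]) (auto dest: indepD)

lemma col_Un:
  assumes "col A i" "col B j"
  shows "col (A \<union> B) (i + j)"
proof -
  obtain c :: "'a \<Rightarrow> nat" where c: "\<And>v. v \<in> A \<Longrightarrow> c v < i" "\<And>u v. u \<in> A \<Longrightarrow> v \<in> A \<Longrightarrow> E u v \<Longrightarrow> c u \<noteq> c v"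
    using colE[OF assms(1)] by metis
  obtain d :: "'a \<Rightarrow> nat" where d: "\<And>v. v \<in> B \<Longrightarrow> d v < j" "\<And>u v. u \<in> B \<Longrightarrow> v \<in> B \<Longrightarrow> E u v \<Longrightarrow> d u \<noteq> d v"
    using colE[OF assms(2)] by metis
  show ?thesis
  proof (rule colI[where c = "\<lambda>v. if v \<in> A then c v else i + d v"])
    fix v assume "v \<in> A \<union> B"
    then show "(if v \<in> A then c v else i + d v) < i + j"
      using c(1)[of v] d(1)[of v] by (auto split: if_splits)
  next
    fix u v assume uv: "u \<in> A \<union> B" "v \<in> A \<union> B" "E u v"
    then show "(if u \<in> A then c u else i + d u) \<noteq> (if v \<in> A then c v else i + d v)"
      using c(1)[of v] c(1)[of u] c(2)[of u v] d(2)[of u v] by (auto split: if_splits)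
  qed
qed

lemma col_cover: "col A i \<Longrightarrow> col B j \<Longrightarrow> V \<subseteq> A \<union> B \<Longrightarrow> i + j \<le> k \<Longrightarrow> col V k"
  using col_Un col_mono by blast

lemma col_indep_Un: "indep A \<Longrightarrow> indep B \<Longrightarrow> col (A \<union> B) 2"
  using col_Un[OF col_indep col_indep] by (simp add: numeral_eq_Suc)

lemma col_anticomplete:
  assumes "col A k" "col B k" "\<And>u v. u \<in> A \<Longrightarrow> v \<in> B \<Longrightarrow> \<not> E u v"
  shows "col (A \<union> B) k"
proof -
  obtain c :: "'a \<Rightarrow> nat" where c: "\<And>v. v \<in> A \<Longrightarrow> c v < k" "\<And>u v. u \<in> A \<Longrightarrow> v \<in> A \<Longrightarrow> E u v \<Longrightarrow> c u \<noteq> c v"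
    using colE[OF assms(1)] by metis
  obtain d :: "'a \<Rightarrow> nat" where d: "\<And>v. v \<in> B \<Longrightarrow> d v < k" "\<And>u v. u \<in> B \<Longrightarrow> v \<in> B \<Longrightarrow> E u v \<Longrightarrow> d u \<noteq> d v"
    using colE[OF assms(2)] by metis
  show ?thesis
  proof (rule colI[where c = "\<lambda>v. if v \<in> A then c v else d v"])
    fix v assume "v \<in> A \<union> B"
    then show "(if v \<in> A then c v else d v) < k"
      using c(1)[of v] d(1)[of v] by auto
  next
    fix u v assume uv: "u \<in> A \<union> B" "v \<in> A \<union> B" "E u v"
    then show "(if u \<in> A then c u else d u) \<noteq> (if v \<in> A then c v else d v)"
      using c(2)[of u v] d(2)[of u v] assms(3)[of u v] assms(3)[of v u] symE[of u v] by auto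
  qed
qed

text \<open>Under a numbering of the vertices, \<open>W\<close> takes the larger end of each edge.
  That every vertex of \<open>W\<close> has a mate is needed in the final case.\<close>

lemma matching_split:
  assumes "A \<subseteq> V" and m: "\<And>u v w. u \<in> A \<Longrightarrow> v \<in> A \<Longrightarrow> w \<in> A \<Longrightarrow> E u v \<Longrightarrow> E u w \<Longrightarrow> v = w"
  obtains W where "W \<subseteq> A" "indep W" "indep (A - W)" "\<And>w. w \<in> W \<Longrightarrow> \<exists>u\<in>A. E w u"
proof -
  obtain f :: "'a \<Rightarrow> nat" where f: "inj_on f V"
    using finite_imp_inj_to_nat_seg[OF finV] by blast
  define W where "W = {v\<in>A. \<exists>u\<in>A. E v u \<and> f u < f v}"
  show thesis
  proof (rule that[of W])
    show "W \<subseteq> A" "\<And>w. w \<in> W \<Longrightarrow> \<exists>u\<in>A. E w u"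
      unfolding W_def by blast+
    show "indep W"
    proof (rule indepI)
      fix u v assume uv: "u \<in> W" "v \<in> W" "E u v"
      obtain u' where u': "u' \<in> A" "E u u'" "f u' < f u" using uv unfolding W_def by blast
      obtain v' where v': "v' \<in> A" "E v v'" "f v' < f v" using uv unfolding W_def by blast
      have "u' = v" "v' = u"
        using m[of u u' v] m[of v v' u] u' v' uv symE unfolding W_def by blast+
      then show False using u' v' by simp
    qed
    show "indep (A - W)"
    proof (rule indepI)
      fix u v assume uv: "u \<in> A - W" "v \<in> A - W" "E u v"
      then have "u \<noteq> v" using irrE by blast
      then have "f u \<noteq> f v" using f uv assms(1) by (meson DiffD1 inj_onD subsetD)
      then show False using uv symE[of u v] unfolding W_def by (auto simp: nat_neq_iff)
    qed
  qed
qed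

lemma col_matching:
  assumes "A \<subseteq> V" "\<And>u v w. u \<in> A \<Longrightarrow> v \<in> A \<Longrightarrow> w \<in> A \<Longrightarrow> E u v \<Longrightarrow> E u w \<Longrightarrow> v = w"
  shows "col A 2"
proof -
  obtain W where "W \<subseteq> A" "indep W" "indep (A - W)"
    by (rule matching_split[OF assms])
  then show ?thesis using col_indep_Un[of W "A - W"] by (simp add: Un_absorb1)
qed

section \<open>Connected components\<close>

definition component :: "'a set \<Rightarrow> 'a \<Rightarrow> 'a set" where
  "component M q = {r. (q, r) \<in> {(u, v). u \<in> M \<and> v \<in> M \<and> E u v}\<^sup>*}"

lemma component_refl: "q \<in> component M q"
  unfolding component_def by simp

lemma component_subset: "q \<in> M \<Longrightarrow> component M q \<subseteq> M"
proof
  fix r assume "q \<in> M" "r \<in> component M q"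
  then have "(q, r) \<in> {(u, v). u \<in> M \<and> v \<in> M \<and> E u v}\<^sup>*" by (simp add: component_def)
  then show "r \<in> M" using \<open>q \<in> M\<close> by (induction rule: rtrancl_induct) auto
qed

lemma component_step: "u \<in> component M q \<Longrightarrow> q \<in> M \<Longrightarrow> v \<in> M \<Longrightarrow> E u v \<Longrightarrow> v \<in> component M q"
  using component_subset[of q M] unfolding component_def
  by (auto intro: rtrancl_into_rtrancl)

lemma component_eq: "r \<in> component M q \<Longrightarrow> component M r = component M q"
proof -
  let ?R = "{(u, v). u \<in> M \<and> v \<in> M \<and> E u v}"
  have "sym ?R" using symE by (auto intro: symI)
  then have "sym (?R\<^sup>*)" by (rule sym_rtrancl)
  then show "r \<in> component M q \<Longrightarrow> component M r = component M q"
    unfolding component_def by (auto dest: symD intro: rtrancl_trans)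
qed

lemma component_induct [consumes 1, case_names base step]:
  assumes "r \<in> component M q" "P q"
    "\<And>u v. u \<in> component M q \<Longrightarrow> v \<in> component M q \<Longrightarrow> u \<in> M \<Longrightarrow> v \<in> M \<Longrightarrow> E u v \<Longrightarrow> P u \<Longrightarrow> P v"
  shows "P r"
proof -
  let ?R = "{(u, v). u \<in> M \<and> v \<in> M \<and> E u v}"
  have "(q, r) \<in> ?R\<^sup>*" using assms(1) by (simp add: component_def)
  then show ?thesis
  proof (induction rule: rtrancl_induct)
    case base then show ?case by (rule assms(2))
  next
    case (step y z)
    show ?case
      by (rule assms(3)[of y z]) (use step in \<open>auto simp: component_def intro: rtrancl_into_rtrancl\<close>)
  qed
qed

lemma col_components:
  assumes "\<And>q. q \<in> M \<Longrightarrow> col (component M q) k"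
  shows "col M k"
proof -
  \<comment> \<open>The choice depends on the component as a set, so adjacent vertices consult the
    same coloring.\<close>
  define F where "F Q = (SOME c::'a \<Rightarrow> nat. (\<forall>v\<in>Q. c v < k) \<and> (\<forall>u\<in>Q. \<forall>v\<in>Q. E u v \<longrightarrow> c u \<noteq> c v))" for Q
  have F: "(\<forall>v\<in>component M q. F (component M q) v < k) \<and>
      (\<forall>u\<in>component M q. \<forall>v\<in>component M q. E u v \<longrightarrow> F (component M q) u \<noteq> F (component M q) v)" if "q \<in> M" for q
    using assms[OF that] unfolding col_def F_def by (rule someI_ex)
  show ?thesis
  proof (rule colI[where c = "\<lambda>v. F (component M v) v"])
    fix v assume "v \<in> M" then show "F (component M v) v < k" using F component_refl by blast
  next
    fix u v assume uv: "u \<in> M" "v \<in> M" "E u v"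
    then have "v \<in> component M u" using component_step component_refl by blast
    then have "component M v = component M u" by (rule component_eq)
    then show "F (component M u) u \<noteq> F (component M v) v"
      using F[of u] uv \<open>v \<in> component M u\<close> component_refl by metis
  qed
qed

end

text \<open>All six vertices of an induced path, and the triangle part of the other two graphs, are
  automatically distinct; only the two twins of the dart need an explicit inequality.\<close>

locale free_graph = sgraph +
  assumes P6: "\<lbrakk>E a b; E b c; E c d; E d e; E e f; \<not> E a c; \<not> E a d; \<not> E a e; \<not> E a f;
      \<not> E b d; \<not> E b e; \<not> E b f; \<not> E c e; \<not> E c f; \<not> E d f\<rbrakk> \<Longrightarrow> False"
    and dart: "\<lbrakk>E a b; E a c; E a d; E b c; E b d; \<not> E c d; c \<noteq> d; E a e; \<not> E e b; \<not> E e c; \<not> E e d\<rbrakk> \<Longrightarrow> False"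
    and K4: "\<lbrakk>E a b; E a c; E a d; E b c; E b d; E c d\<rbrakk> \<Longrightarrow> False"

section \<open>Minimal graphs that are not 6-colorable\<close>

locale min_graph = free_graph +
  assumes not6: "\<not> col V 6"
    and min6: "A \<subset> V \<Longrightarrow> col A 6"
begin

text \<open>The rest is 6-colorable by minimality, and at most \<open>j\<close> colors appear on
  \<open>S\<close>; a \<open>k\<close>-coloring of \<open>Q\<close> can be renamed into the
  remaining ones.\<close>

lemma extend_cut:
  assumes Q: "Q \<subseteq> V" "Q \<noteq> {}" and S: "\<And>u v. u \<in> V - Q \<Longrightarrow> v \<in> Q \<Longrightarrow> E u v \<Longrightarrow> u \<in> S"
    and fin: "finite S" and cardS: "card S \<le> j" and colQ: "col Q k" and jk: "j + k \<le> 6"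
  shows False
proof -
  have "V - Q \<subset> V" using Q by blast
  then obtain c :: "'a \<Rightarrow> nat" where c: "\<And>v. v \<in> V - Q \<Longrightarrow> c v < 6"
      "\<And>u v. u \<in> V - Q \<Longrightarrow> v \<in> V - Q \<Longrightarrow> E u v \<Longrightarrow> c u \<noteq> c v"
    using colE[OF min6[of "V - Q"]] by metis
  obtain d :: "'a \<Rightarrow> nat" where d: "\<And>v. v \<in> Q \<Longrightarrow> d v < k"
      "\<And>u v. u \<in> Q \<Longrightarrow> v \<in> Q \<Longrightarrow> E u v \<Longrightarrow> d u \<noteq> d v"
    using colE[OF colQ] by metis
  have "card ({..<6} - c ` S) \<ge> k"
  proof -
    have "card (c ` S) \<le> j" using card_image_le[OF fin, of c] cardS by linarith
    then show ?thesis
      using diff_card_le_card_Diff[of "c ` S" "{..<6::nat}"] fin jk by simp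
  qed
  then obtain g where g: "inj_on g {..<k}" "g ` {..<k} \<subseteq> {..<6} - c ` S"
    by (metis card_le_inj card_lessThan finite_Diff finite_lessThan)
  have "col V 6"
  proof (rule colI[where c = "\<lambda>v. if v \<in> Q then g (d v) else c v"])
    fix v assume "v \<in> V" then show "(if v \<in> Q then g (d v) else c v) < 6"
      using c(1) d(1) g(2) by force
  next
    have cross: "c u \<noteq> g (d v)" if "u \<in> V - Q" "v \<in> Q" "E u v" for u v
      using S[OF that] d(1)[OF that(2)] g(2) by blast
    fix u v assume uv: "u \<in> V" "v \<in> V" "E u v"
    have "g (d u) \<noteq> g (d v)" if "u \<in> Q" "v \<in> Q"
      using d uv that g(1) by (metis inj_onD lessThan_iff)
    then show "(if u \<in> Q then g (d u) else c u) \<noteq> (if v \<in> Q then g (d v) else c v)"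
      using uv cross[of u v] cross[of v u] c(2)[of u v] symE[of u v] by auto
  qed
  then show False using not6 by simp
qed

lemma deg6:
  assumes "v \<in> V" "finite S" "\<And>u. E v u \<Longrightarrow> u \<in> S"
  shows "card S \<ge> 6"
proof (rule ccontr)
  assume "\<not> 6 \<le> card S"
  then show False
    using extend_cut[of "{v}" S 5 1] assms symE irrE col_indep[of "{v}"] by (auto simp: indep_def)
qed

text \<open>A coloring of \<open>V - {u}\<close> extends by giving \<open>u\<close> the color of
  \<open>v\<close>.\<close>

lemma no_comparable:
  assumes "u \<in> V" "v \<in> V" "u \<noteq> v" "\<not> E u v" "\<And>w. E u w \<Longrightarrow> E v w"
  shows False
proof -
  have "V - {u} \<subset> V" using assms by blast
  then obtain c :: "'a \<Rightarrow> nat" where c: "\<And>v. v \<in> V - {u} \<Longrightarrow> c v < 6"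
      "\<And>w v. w \<in> V - {u} \<Longrightarrow> v \<in> V - {u} \<Longrightarrow> E w v \<Longrightarrow> c w \<noteq> c v"
    using colE[OF min6[of "V - {u}"]] by metis
  have "col V 6"
  proof (rule colI[where c = "c(u := c v)"])
    fix w assume "w \<in> V" then show "(c(u := c v)) w < 6" using c(1) assms by auto
  next
    fix w w' assume w: "w \<in> V" "w' \<in> V" "E w w'"
    then show "(c(u := c v)) w \<noteq> (c(u := c v)) w'"
      using c(2)[of w w'] c(2)[of v w'] c(2)[of w v] assms(2,3) assms(5)[of w] assms(5)[of w'] irrE
        symE[of w u] symE[of v w] by (cases "w = u"; cases "w' = u") auto
  qed
  then show False using not6 by simp
qed

definition nbhd :: "'a \<Rightarrow> 'a set" where "nbhd v = {u. E v u}"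

lemma nbhd_fin: "finite (nbhd v)"
  using finV inV2 by (metis (mono_tags, lifting) finite_subset mem_Collect_eq nbhd_def subsetI)

lemma nbhd_card: "v \<in> V \<Longrightarrow> card (nbhd v) \<ge> 6"
  using deg6[of v "nbhd v"] nbhd_fin by (simp add: nbhd_def)

end


section \<open>Edges in two triangles\<close>

context min_graph
begin

text \<open>By K4-freeness the common neighbours of \<open>v\<close> and \<open>b\<close> are
  independent, so \<open>e\<close> misses at most one of them, or it is the pendant vertex of a
  dart. If it misses \<open>u\<close>, then \<open>v\<close>, \<open>e\<close> and two other common
  neighbours form a diamond with \<open>u\<close> pendant at \<open>v\<close>.\<close>

lemma thick3:
  assumes "E v b" "E v c" "E b c" "E v d" "E b d" "E v f" "E b f" "c \<noteq> d" "c \<noteq> f" "d \<noteq> f"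
    and "E v e" "\<not> E e b" "e \<noteq> b" "E v u" "E b u"
  shows "E e u"
proof (rule ccontr)
  assume n: "\<not> E e u"
  have indepC: "\<not> E x y" if "E v x" "E b x" "E v y" "E b y" for x y
    using K4[of v b x y] that assms(1) by blast
  have two: "E e x \<or> E e y" if "E v x" "E b x" "E v y" "E b y" "x \<noteq> y" for x y
    using dart[of v b x y e] that assms indepC[of x y] by blast
  obtain x y where xy: "E v x" "E b x" "E v y" "E b y" "x \<noteq> y" "x \<noteq> u" "y \<noteq> u"
    using assms by metis
  have "E e x" "E e y"
    using two[of u x] two[of u y] xy assms n by auto
  then show False
    using dart[of v e x y u] xy assms indepC[of x y] indepC[of u x] indepC[of u y] n symE by metis
qed

text \<open>If there are only two common neighbours, the degree bound puts three vertices into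
  \<open>F\<close>. Each sees \<open>c\<close> or \<open>d\<close>, so two of them see the same one,
  \<open>c'\<close>. Now \<open>v\<close> and \<open>c'\<close> have three common neighbours and
  \<open>thick3\<close> applies to them: a vertex of \<open>F\<close> that misses \<open>c'\<close>
  would have to see \<open>b\<close>, and \<open>d'\<close> sees all common neighbours of
  \<open>v\<close> and \<open>c'\<close>.\<close>

lemma thick_complete:
  assumes vb: "E v b" and c: "E v c" "E b c" and d: "E v d" "E b d" and cd: "c \<noteq> d"
    and e: "E v e" "\<not> E e b" "e \<noteq> b" and u: "E v u" "E b u"
  shows "E e u"
proof (cases "\<exists>f. E v f \<and> E b f \<and> f \<noteq> c \<and> f \<noteq> d")
  case True
  then obtain f where "E v f" "E b f" "f \<noteq> c" "f \<noteq> d" by blast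
  then show ?thesis using thick3[OF vb c d, of f e u] cd e u by auto
next
  case False
  then have only: "x = c \<or> x = d" if "E v x" "E b x" for x using that by blast
  have ncd: "\<not> E c d" using K4 vb c d by blast
  define F where "F = {e. E v e \<and> \<not> E e b \<and> e \<noteq> b}"
  have F: "E v x" "\<not> E x b" "x \<noteq> b" if "x \<in> F" for x
    using that unfolding F_def by auto
  have two: "E x c \<or> E x d" if "x \<in> F" for x
    using dart[OF vb c(1) d(1) c(2) d(2) ncd cd F(1,2)[OF that]] by blast
  have core: "E e' u'" if cd': "E v c'" "E b c'" "E v d'" "E b d'" "c' \<noteq> d'" "\<not> E c' d'"
      "e1 \<in> F" "e2 \<in> F" "e1 \<noteq> e2" "E e1 c'" "E e2 c'" "e' \<in> F" "u' = c' \<or> u' = d'" for c' d' e1 e2 e' u'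
  proof -
    have e12: "e1 \<noteq> b" "e2 \<noteq> b" "E v e1" "E v e2" using F cd' by auto
    have th: "E x y" if "E v x" "\<not> E x c'" "x \<noteq> c'" "E v y" "E c' y" for x y
    proof -
      have "E c' b" "E c' e1" "E c' e2" using cd' symE by metis+
      then show ?thesis using thick3[of v c' b e1 e2 x y] that cd' e12 vb by metis
    qed
    have 1: "E e' c'"
    proof (rule ccontr)
      assume "\<not> E e' c'"
      moreover have "e' \<noteq> c'" using F(2)[OF \<open>e' \<in> F\<close>] cd' symE[of b c'] by blast
      ultimately have "E e' b" using th[of e' b] F(1)[OF \<open>e' \<in> F\<close>] vb symE[of b c'] cd' by blast
      then show False using F(2)[OF \<open>e' \<in> F\<close>] by blast
    qed
    have "E d' e'"
      using th[of d' e'] cd' 1 symE[of e' c'] symE[of d' c'] F(1)[OF \<open>e' \<in> F\<close>] by blast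
    then show ?thesis using 1 symE[of d' e'] \<open>u' = c' \<or> u' = d'\<close> by blast
  qed
  have "finite F" using nbhd_fin[of v] by (rule rev_finite_subset) (auto simp: F_def nbhd_def)
  have "nbhd v \<subseteq> {b, c, d} \<union> F"
    unfolding F_def nbhd_def using only E_commute[of b] by auto
  then have "card (nbhd v) \<le> card {b, c, d} + card F"
    by (meson \<open>finite F\<close> card_Un_le card_mono finite.emptyI finite.insertI finite_UnI le_trans)
  moreover have "card {b, c, d} \<le> 3" by (simp add: card_insert_if)
  ultimately have "card F \<ge> 3" using nbhd_card[of v] vb inV[of v b] by linarith
  then obtain a1 a2 a3 where a: "a1 \<in> F" "a2 \<in> F" "a3 \<in> F" "a1 \<noteq> a2" "a1 \<noteq> a3" "a2 \<noteq> a3"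
    using \<open>finite F\<close> by (auto simp: card_le_Suc_iff numeral_eq_Suc)
  have "\<exists>e1 e2. e1 \<in> F \<and> e2 \<in> F \<and> e1 \<noteq> e2 \<and> (E e1 c \<and> E e2 c \<or> E e1 d \<and> E e2 d)"
    using two[OF a(1)] two[OF a(2)] two[OF a(3)] a by metis
  moreover have "e \<in> F" using e F_def by auto
  moreover have "u = c \<or> u = d" using only u by blast
  ultimately show ?thesis
    using core[of c d _ _ e u] core[of d c _ _ e u] c d cd ncd symE by metis
qed

definition thick :: "'a \<Rightarrow> 'a \<Rightarrow> bool" where
  "thick v b \<longleftrightarrow> E v b \<and> (\<exists>c d. c \<noteq> d \<and> E v c \<and> E b c \<and> E v d \<and> E b d)"

lemma thickI: "E v b \<Longrightarrow> E v c \<Longrightarrow> E b c \<Longrightarrow> E v d \<Longrightarrow> E b d \<Longrightarrow> c \<noteq> d \<Longrightarrow> thick v b"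
  unfolding thick_def by blast

lemma thick_E: "thick v b \<Longrightarrow> E v b"
  unfolding thick_def by blast

lemma thick_sym: "thick v b \<Longrightarrow> thick b v"
  unfolding thick_def using symE by blast

text \<open>Otherwise \<open>u\<close> dominates \<open>b\<close>. The critical neighbours
  \<open>w\<close> of \<open>b\<close> are those that miss \<open>v\<close>: they see
  \<open>c\<close>, and \<open>thick_complete\<close> for the edge from \<open>c\<close> to
  \<open>v\<close>, with common neighbours \<open>b\<close> and \<open>u\<close>, makes them see
  \<open>u\<close>.\<close>

lemma thick_twin:
  assumes "thick v b" "E v u" "u \<noteq> b"
  shows "E b u"
proof (rule ccontr)
  assume nu: "\<not> E b u"
  obtain c d where cd: "c \<noteq> d" "E v c" "E b c" "E v d" "E b d" and vb: "E v b"
    using assms unfolding thick_def by blast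
  have uc: "E u c" "E u d"
    using thick_complete[OF vb cd(2-5) cd(1), of u] assms nu cd symE by metis+
  have "E u w" if bw: "E b w" for w
  proof (cases "w = v \<or> E v w")
    case True
    then show ?thesis
      using thick_complete[OF vb cd(2-5) cd(1), of u w] assms nu bw symE by metis
  next
    case False
    have wc: "E w c"
      using thick_complete[of b v c d w c] vb cd symE bw False by metis
    have "E w u"
      by (rule thick_complete[of c v b u w u]) (use cd assms uc wc vb False symE in metis)+
    then show ?thesis by (rule symE)
  qed
  moreover have "b \<in> V" "u \<in> V" using vb assms inV2 by auto
  ultimately show False using no_comparable[of b u] nu assms by blast
qed

lemma thick_indep: "thick v b \<Longrightarrow> E v u \<Longrightarrow> E v w \<Longrightarrow> u \<noteq> b \<Longrightarrow> w \<noteq> b \<Longrightarrow> \<not> E u w"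
  using K4[of v b u w] thick_twin thick_E by blast

lemma thick_unique:
  assumes "thick v b" "thick v b'"
  shows "b = b'"
proof (rule ccontr)
  assume ne: "b \<noteq> b'"
  obtain c where "E v c" "E b' c" "c \<noteq> b" using assms(2) unfolding thick_def by metis
  then show False using thick_indep[OF assms(1), of c b'] thick_E[OF assms(2)] ne symE by metis
qed

text \<open>A twin \<open>w\<close> of \<open>u\<close> would see \<open>v\<close> as well, but the
  neighbours of \<open>v\<close> other than its twin are independent.\<close>

lemma thick_no_adj:
  assumes "thick v a" "E v u" "u \<noteq> a"
  shows "\<not> thick u w"
proof
  assume t: "thick u w"
  have "w \<noteq> v" using t assms thick_unique thick_sym by blast
  then have "E w v" using thick_twin[OF t, of v] assms symE by metis
  have "w \<noteq> a"
  proof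
    assume "w = a"
    then have "u = v" using thick_unique[of a u v] t assms thick_sym by blast
    then show False using assms irrE by blast
  qed
  then show False using thick_indep[OF assms(1,2), of w] \<open>E w v\<close> assms thick_E[OF t] symE by metis
qed

lemma nonthick_unique: "\<not> thick u v \<Longrightarrow> E u v \<Longrightarrow> E u x \<Longrightarrow> E v x \<Longrightarrow> E u y \<Longrightarrow> E v y \<Longrightarrow> x = y"
  unfolding thick_def by blast

lemma col_nbhd: "col (nbhd v) 2"
proof (cases "\<exists>a. thick v a")
  case True
  then obtain a where a: "thick v a" by blast
  have "indep (nbhd v - {a})" using thick_indep[OF a] unfolding indep_def nbhd_def by blast
  moreover have "indep {a}" using irrE by (auto simp: indep_def)
  ultimately have "col (nbhd v - {a} \<union> {a}) 2" by (rule col_indep_Un)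
  then show ?thesis by (rule col_mono) auto
next
  case False
  show ?thesis
  proof (rule col_matching)
    show "nbhd v \<subseteq> V" using inV2 unfolding nbhd_def by blast
    show "x = y" if "u \<in> nbhd v" "x \<in> nbhd v" "y \<in> nbhd v" "E u x" "E u y" for u x y
      using nonthick_unique[of v u x y] False that unfolding nbhd_def by blast
  qed
qed

text \<open>No induced \<open>P\<^sub>4\<close> starts in \<open>p\<close> and continues in \<open>M\<close>. This holds as soon as \<open>p\<close> is the end of an
  induced \<open>P\<^sub>3\<close> whose other two vertices have no neighbour in \<open>M\<close>.\<close>

definition no_long_entry :: "'a \<Rightarrow> 'a set \<Rightarrow> bool" where
  "no_long_entry p M \<longleftrightarrow> (\<forall>a\<in>M. \<forall>b\<in>M. \<forall>c\<in>M. E p a \<longrightarrow> E a b \<longrightarrow> E b c \<longrightarrow> E p b \<or> E p c \<or> E a c)"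

lemma no_long_entry_tail:
  assumes "E t1 p" "E t2 t1" "\<not> E t2 p" "\<And>m. m \<in> M \<Longrightarrow> \<not> E t1 m \<and> \<not> E t2 m"
  shows "no_long_entry p M"
  unfolding no_long_entry_def using P6[of t2 t1 p] assms by blast

definition shallow :: "'a set \<Rightarrow> bool" where
  "shallow M \<longleftrightarrow> M \<subset> V \<and> (\<forall>p q. p \<notin> M \<longrightarrow> q \<in> M \<longrightarrow> E p q \<longrightarrow> no_long_entry p M)"

definition isolated_triangle :: "'a set \<Rightarrow> 'a \<Rightarrow> 'a \<Rightarrow> 'a \<Rightarrow> bool" where
  "isolated_triangle M r s n \<longleftrightarrow> r \<in> M \<and> s \<in> M \<and> n \<in> M \<and> E r s \<and> E r n \<and> E s n \<and>
     \<not> thick r s \<and> \<not> thick r n \<and> \<not> thick s n \<and>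
     (\<forall>u\<in>M. (E r u \<longrightarrow> u = s \<or> u = n) \<and> (E s u \<longrightarrow> u = r \<or> u = n) \<and> (E n u \<longrightarrow> u = r \<or> u = s))"

section \<open>Components of a shallow set\<close>

context
  fixes M q Q
  assumes M: "shallow M" and q: "q \<in> M" and Q: "Q = component M q"
begin

lemma QM: "Q \<subseteq> M"
  using component_subset[OF q] Q by simp

lemma Qstep: "u \<in> Q \<Longrightarrow> v \<in> M \<Longrightarrow> E u v \<Longrightarrow> v \<in> Q"
  using component_step q Q by blast

lemma Q_closed: "P x \<Longrightarrow> x \<in> Q \<Longrightarrow> (\<And>u v. u \<in> Q \<Longrightarrow> v \<in> Q \<Longrightarrow> E u v \<Longrightarrow> P u \<Longrightarrow> P v) \<Longrightarrow> y \<in> Q \<Longrightarrow> P y"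
  using component_induct[of y M x P] component_eq[of x M q] Q by metis

lemma farQ: "p \<notin> M \<Longrightarrow> a \<in> Q \<Longrightarrow> b \<in> Q \<Longrightarrow> c \<in> Q \<Longrightarrow> E p a \<Longrightarrow> E a b \<Longrightarrow> E b c \<Longrightarrow> E p b \<or> E p c \<or> E a c"
  using M QM unfolding shallow_def no_long_entry_def by blast

lemma dist2:
  assumes p: "p \<notin> M" and m: "m \<in> Q" "E p m" and u: "u \<in> Q"
  shows "E p u \<or> (\<exists>n\<in>Q. E p n \<and> E n u)"
proof (rule Q_closed[where P = "\<lambda>u. E p u \<or> (\<exists>n\<in>Q. E p n \<and> E n u)" and x = m and y = u])
  fix u v assume uv: "u \<in> Q" "v \<in> Q" "E u v" and h: "E p u \<or> (\<exists>n\<in>Q. E p n \<and> E n u)"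
  show "E p v \<or> (\<exists>n\<in>Q. E p n \<and> E n v)"
    using h farQ[OF p, of _ u v] uv by blast
qed (use m u in auto)

text \<open>Suppose \<open>u\<close> is another neighbour of \<open>r\<close>. If \<open>p\<close>
  sees \<open>u\<close>, the entry \<open>p\<close>, \<open>u\<close>, \<open>r\<close>,
  \<open>s\<close> makes \<open>u\<close> a second common neighbour of \<open>r\<close> and
  \<open>s\<close>. If not, the entry \<open>p\<close>, \<open>n\<close>, \<open>r\<close>,
  \<open>u\<close> makes \<open>n\<close> and \<open>r\<close> twins, and \<open>p\<close> would see
  \<open>r\<close>.\<close>

lemma tri_step:
  assumes p: "p \<notin> M" and rs: "r \<in> Q" "s \<in> Q" "E r s" "\<not> thick r s" "\<not> E p r" "\<not> E p s"
    and n: "n \<in> Q" "E p n" "E n r" "E n s" and u: "u \<in> M" "E r u"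
  shows "u = s \<or> u = n"
proof (rule ccontr)
  assume ne: "\<not> ?thesis"
  have uQ: "u \<in> Q" using Qstep rs(1) u by blast
  show False
  proof (cases "E p u")
    case True
    then have "E u s" using farQ[OF p uQ rs(1,2)] rs u symE by metis
    then show False using nonthick_unique[OF rs(4,3), of u n] u n symE ne by metis
  next
    case False
    have "E n u" using farQ[OF p n(1) rs(1) uQ] n rs u False by blast
    then have "thick n r" using thickI[of n r s u] n rs u ne by blast
    moreover have "p \<noteq> r" using p rs(1) QM by blast
    ultimately have "E r p" using thick_twin[of n r p] n(2) symE by blast
    then show False using rs(5) symE by metis
  qed
qed

lemma tri_nonthick:
  assumes "\<not> E p r" "E p n" "E n r" "p \<notin> M" "r \<in> Q"
  shows "\<not> thick r n"
proof
  assume "thick r n"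
  moreover have "p \<noteq> r" using assms QM by blast
  ultimately have "E r p"
    using thick_twin[OF thick_sym, of r n p] assms(2) symE by blast
  then show False using assms symE by metis
qed

text \<open>\<open>tri_step\<close> settles the neighbours of \<open>r\<close> and \<open>s\<close>.
  For those of \<open>n\<close> it needs an outside vertex that sees \<open>r\<close> and misses
  \<open>s\<close> and \<open>n\<close>: the degree bound gives a neighbour of \<open>r\<close>
  outside \<open>M\<close>, and edges that are not thick have at most one common neighbour.\<close>

lemma tri_or_cover:
  assumes p: "p \<notin> M" and m: "m \<in> Q" "E p m" and rs: "r \<in> Q" "s \<in> Q" "E r s" "\<not> thick r s" "\<not> E p r" "\<not> E p s"
  obtains n where "isolated_triangle M r s n" "Q = {r, s, n}"
proof -
  obtain n where n: "n \<in> Q" "E p n" "E n r" using dist2[OF p m rs(1)] rs by blast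
  have ns: "E n s" using farQ[OF p n(1) rs(1,2)] n rs by blast
  have nt: "\<not> thick r n" "\<not> thick s n" using tri_nonthick p n ns rs by blast+
  have r: "u = s \<or> u = n" if "u \<in> M" "E r u" for u
    using tri_step[OF p rs n ns that] .
  have s: "u = r \<or> u = n" if "u \<in> M" "E s u" for u
    by (rule tri_step[OF p rs(2,1) _ _ rs(6,5) n(1,2) ns n(3)]) (use that rs symE thick_sym in metis)+
  obtain p' where p': "p' \<notin> M" "E r p'"
  proof -
    have "\<not> nbhd r \<subseteq> {s, n}"
    proof
      assume "nbhd r \<subseteq> {s, n}"
      then have "card (nbhd r) \<le> card {s, n}" by (intro card_mono) auto
      then show False using nbhd_card[of r] rs(3) inV by (auto simp: card_insert_if split: if_splits)
    qed
    then show thesis using that r unfolding nbhd_def by blast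
  qed
  have "p' \<noteq> n" "p' \<noteq> s" using p'(1) n(1) rs(2) QM by blast+
  then have "\<not> E p' s" "\<not> E p' n"
    using nonthick_unique[of r s p' n] nonthick_unique[of r n p' s] rs(3,4) nt(1) n(3) ns p'(2) symE by metis+
  then have nn: "u = s \<or> u = r" if "u \<in> M" "E n u" for u
    by (intro tri_step[OF p'(1) n(1) rs(2) ns _ _ _ rs(1)]) (use that nt rs n p' symE thick_sym in metis)+
  have "isolated_triangle M r s n" unfolding isolated_triangle_def using rs(1-4) n(1) nt QM symE[OF n(3)] symE[OF ns] r s nn by blast
  moreover have "y \<in> {r, s, n}" if "y \<in> Q" for y
    by (rule Q_closed[where P = "\<lambda>u. u \<in> {r, s, n}", OF _ rs(1) _ that])
      (use r s nn QM in auto)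
  ultimately show thesis using that rs n by blast
qed


lemma attached: obtains p m where "p \<notin> M" "m \<in> Q" "E p m"
proof -
  have QV: "Q \<subset> V" using QM M unfolding shallow_def by blast
  have "\<exists>u v. u \<in> V - Q \<and> v \<in> Q \<and> E u v"
    using extend_cut[of Q "{}" 0 6] QV min6[of Q] component_refl[of q M] Q by (metis card.empty emptyE finite.emptyI
        le_refl plus_nat.add_0 psubset_imp_subset)
  then obtain u v where uv: "u \<in> V - Q" "v \<in> Q" "E u v" by blast
  then have "u \<notin> M" using Qstep[of v u] symE by blast
  then show thesis using that uv by blast
qed

definition covers :: bool where
  "covers \<longleftrightarrow> (\<forall>p m u w. p \<notin> M \<longrightarrow> m \<in> Q \<longrightarrow> E p m \<longrightarrow> u \<in> Q \<longrightarrow> w \<in> Q \<longrightarrow> E u w \<longrightarrow> \<not> thick u w \<longrightarrow> E p u \<or> E p w)"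

lemma tri_cases: "covers \<or> (\<exists>r s n. isolated_triangle M r s n \<and> Q = {r, s, n})"
  unfolding covers_def using tri_or_cover by metis

text \<open>If \<open>p\<close> alone is attached, the part of \<open>Q\<close> that it misses has
  only thick edges, which form a matching. With the neighbourhood of \<open>p\<close> this makes 2 +
  2 colors for \<open>Q\<close>, and a cut vertex leaves five.\<close>

lemma covers_two_attached:
  assumes covers
  obtains (two) p m p' m' where "p \<notin> M" "m \<in> Q" "E p m" "p' \<notin> M" "m' \<in> Q" "E p' m'" "p \<noteq> p'"
proof (rule ccontr)
  assume neg: "\<not> thesis"
  obtain p m where p: "p \<notin> M" "m \<in> Q" "E p m" by (rule attached)
  have only: "u = p" if "u \<notin> M" "v \<in> Q" "E u v" for u v
  proof (rule ccontr)
    assume "u \<noteq> p"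
    then show False using neg two[OF p that] by blast
  qed
  have "col (Q - nbhd p) 2"
  proof (rule col_matching)
    show "Q - nbhd p \<subseteq> V" using QM M unfolding shallow_def by blast
    show "v = w" if "u \<in> Q - nbhd p" "v \<in> Q - nbhd p" "w \<in> Q - nbhd p" "E u v" "E u w" for u v w
      using assms p that thick_unique[of u v w] unfolding covers_def nbhd_def by blast
  qed
  then have "col (Q - nbhd p \<union> nbhd p) 4" using col_Un[OF _ col_nbhd, of "Q - nbhd p" 2 p] by simp
  then have "col Q 4" by (rule col_mono) auto
  moreover have "u \<in> {p}" if "u \<in> V - Q" "v \<in> Q" "E u v" for u v
    using only[of u v] Qstep[of v u] that symE[of u v] by blast
  moreover have "Q \<subseteq> V" "Q \<noteq> {}" using QM M p unfolding shallow_def by blast+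
  ultimately show False
    using extend_cut[of Q "{p}" 1 4] by auto
qed

text \<open>A vertex gets color 0 if \<open>p\<close> misses it, 1 if only \<open>p'\<close> misses it, and 2 otherwise. This is proper up to
  the pairs of twins; since twins have the same color
  and all their common neighbours in \<open>Q\<close> have the same other color, one twin of each pair can
  take the third color.\<close>

lemma covers_col3:
  assumes covers
  shows "col Q 3"
proof -
  obtain p m p' m' where p: "p \<notin> M" "m \<in> Q" "E p m" and p': "p' \<notin> M" "m' \<in> Q" "E p' m'" and ne: "p \<noteq> p'"
    using covers_two_attached[OF assms] by metis
  have cov: "E p u \<or> E p w" and cov': "E p' u \<or> E p' w" if "u \<in> Q" "w \<in> Q" "E u w" "\<not> thick u w" for u w
    using assms p p' that unfolding covers_def by blast+
  obtain f :: "'a \<Rightarrow> nat" where f: "inj_on f V"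
    using finite_imp_inj_to_nat_seg[OF finV] by blast
  define upper where "upper s \<longleftrightarrow> (\<exists>r\<in>Q. thick r s \<and> f r < f s)" for s
  \<comment> \<open>A twin marked by \<open>upper\<close> leaves the color of its pair. A pair that
    \<open>p\<close> and \<open>p'\<close> treat alike has color 0 or 2 and its common neighbours
    have the other of these, so 1 is free; for any other pair 0 and 1 are in use.\<close>
  define c where "c u = (if upper u then (if E p u \<longleftrightarrow> E p' u then 1 else 2)
    else if \<not> E p u then 0 else if \<not> E p' u then 1 else 2 :: nat)" for u
  have QV: "Q \<subseteq> V" using QM M unfolding shallow_def by blast
  have main: "c u \<noteq> c w" if uw: "u \<in> Q" "w \<in> Q" "E u w" "\<not> upper u" for u w
  proof (cases "upper w")
    case False
    have nt: "\<not> thick u w"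
    proof
      assume t: "thick u w"
      have "u \<noteq> w" using uw irrE by blast
      then have "f u \<noteq> f w" using f uw QV by (meson inj_onD subsetD)
      then show False using t thick_sym[OF t] uw(1,2,4) False unfolding upper_def by (meson nat_neq_iff)
    qed
    have "\<not> (E p u \<and> E p w \<and> E p' u \<and> E p' w)"
      using nonthick_unique[OF nt uw(3), of p p'] ne
        E_commute[of p] E_commute[of p'] by blast
    then show ?thesis
      using cov[OF uw(1-3) nt] cov'[OF uw(1-3) nt] uw(4) False unfolding c_def by auto
  next
    case True
    then obtain r where r: "r \<in> Q" "thick r w" "f r < f w" unfolding upper_def by blast
    have pne: "p \<noteq> r" "p' \<noteq> r" "p \<noteq> w" "p' \<noteq> w" using p p' r uw QM by blast+
    have prw: "E p r \<longleftrightarrow> E p w" "E p' r \<longleftrightarrow> E p' w"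
      using thick_twin[OF r(2)] thick_twin[OF thick_sym[OF r(2)]] pne E_commute[of p] E_commute[of p'] by blast+
    show ?thesis
    proof (cases "u = r")
      case True
      then show ?thesis using \<open>upper w\<close> uw(4) prw unfolding c_def by auto
    next
      case False
      have ur: "E r u" using thick_twin[OF thick_sym[OF r(2)], of u] uw symE False by blast
      have "\<not> thick u r" using thick_no_adj[OF thick_sym[OF r(2)], of u r] uw symE False by blast
      then have "E p u \<or> E p r" "E p' u \<or> E p' r"
        using cov[OF uw(1) r(1) symE[OF ur]] cov'[OF uw(1) r(1) symE[OF ur]] by blast+
      moreover have "u \<noteq> w" using uw irrE by blast
      then have "\<not> (E p u \<and> E p r)" "\<not> (E p' u \<and> E p' r)"
        using thick_indep[OF r(2), of p u] thick_indep[OF r(2), of p' u] ur pne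
          E_commute[of p r] E_commute[of p' r] by blast+
      ultimately show ?thesis using \<open>upper w\<close> uw(4) prw unfolding c_def by auto
    qed
  qed
  have both: False if uw: "u \<in> Q" "w \<in> Q" "E u w" "upper u" "upper w" for u w
  proof -
    obtain r where r: "thick r w" "f r < f w" using uw unfolding upper_def by blast
    obtain r' where r': "thick r' u" "f r' < f u" using uw unfolding upper_def by blast
    show False
    proof (cases "u = r")
      case True
      then have "r' = w" using thick_unique r r' thick_sym by blast
      then show False using r r' True by simp
    next
      case False
      then show False using thick_no_adj[OF thick_sym[OF r(1)], of u r'] uw symE thick_sym[OF r'(1)] by blast
    qed
  qed
  show ?thesis
  proof (rule colI[where c = c])
    show "c v < 3" for v unfolding c_def by auto
    show "c u \<noteq> c w" if "u \<in> Q" "w \<in> Q" "E u w" for u w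
      using main[of u w] main[of w u] both[of u w] that symE by metis
  qed
qed

end

lemma shallow_col3:
  assumes "shallow M"
  shows "col M 3"
proof (rule col_components)
  fix q assume q: "q \<in> M"
  from tri_cases[OF assms q refl] show "col (component M q) 3"
  proof (elim disjE exE conjE)
    assume "covers M (component M q)"
    then show ?thesis by (rule covers_col3[OF assms q refl])
  next
    fix r s n assume "component M q = {r, s, n}"
    moreover have "col ({r} \<union> ({s} \<union> {n})) (1 + (1 + 1))"
      by (intro col_Un col_indep) (auto simp: indep_def irrE)
    ultimately show ?thesis by (simp add: insert_commute numeral_eq_Suc)
  qed
qed


section \<open>Triangle-free graphs and graphs with twins\<close>

lemma shallowI:
  assumes "M \<subseteq> V" "t \<in> V" "t \<notin> M"
    and "\<And>p q. p \<notin> M \<Longrightarrow> q \<in> M \<Longrightarrow> E p q \<Longrightarrow>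
      \<exists>t1 t2. E t1 p \<and> E t2 t1 \<and> \<not> E t2 p \<and> (\<forall>m\<in>M. \<not> E t1 m \<and> \<not> E t2 m)"
  shows "shallow M"
proof -
  have "no_long_entry p M" if "p \<notin> M" "q \<in> M" "E p q" for p q
    using assms(4)[OF that] no_long_entry_tail by metis
  then show ?thesis unfolding shallow_def using assms(1-3) by blast
qed

text \<open>Without triangles the neighbourhoods of the ends of an edge are independent, and every
  attached vertex extends the edge to an induced P3: 3 + 2 colors.\<close>

lemma triangle_exists: "\<exists>x y z. E x y \<and> E y z \<and> E x z"
proof (rule ccontr)
  assume "\<not> ?thesis"
  then have tf: "\<And>x y z. E x y \<Longrightarrow> E y z \<Longrightarrow> E x z \<Longrightarrow> False" by blast
  have "V \<noteq> {}" using not6 by (auto simp: col_def)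
  then obtain u where u: "u \<in> V" by blast
  have "nbhd u \<noteq> {}" using nbhd_card[OF u] by auto
  then obtain v where v: "E u v" unfolding nbhd_def by blast
  let ?M = "V - nbhd u - nbhd v"
  have "shallow ?M"
  proof (rule shallowI[of _ u])
    show "u \<notin> ?M" using v symE unfolding nbhd_def by blast
    fix p q assume pq: "p \<notin> ?M" "q \<in> ?M" "E p q"
    have "E u p \<or> E v p" using pq inV[of p q] unfolding nbhd_def by blast
    then show "\<exists>t1 t2. E t1 p \<and> E t2 t1 \<and> \<not> E t2 p \<and> (\<forall>m\<in>?M. \<not> E t1 m \<and> \<not> E t2 m)"
    proof
      assume "E u p"
      then have "E u p \<and> E v u \<and> \<not> E v p \<and> (\<forall>m\<in>?M. \<not> E u m \<and> \<not> E v m)"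
        using tf[of u v p] v E_commute[of v u] unfolding nbhd_def by blast
      then show ?thesis by blast
    next
      assume "E v p"
      then have "E v p \<and> E u v \<and> \<not> E u p \<and> (\<forall>m\<in>?M. \<not> E v m \<and> \<not> E u m)"
        using tf[of u v p] v E_commute[of v u] unfolding nbhd_def by blast
      then show ?thesis by blast
    qed
  qed (use u in auto)
  then have "col ?M 3" by (rule shallow_col3)
  moreover have "indep (nbhd u)" "indep (nbhd v)" unfolding indep_def nbhd_def using tf by blast+
  then have "col (nbhd u \<union> nbhd v) 2" by (rule col_indep_Un)
  ultimately show False using col_cover[of ?M 3 "nbhd u \<union> nbhd v" 2 6] not6 by auto
qed

text \<open>The edge from \<open>v\<close> to a common neighbour \<open>b\<close> plays the part of
  the triangle. The neighbours of \<open>v\<close> other than \<open>a\<close> are independent, and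
  \<open>a\<close> is in the neighbourhood of \<open>b\<close>, which takes two colors: 3 + 1 +
  2.\<close>

lemma not_thick: "\<not> thick v a"
proof
  assume va: "thick v a"
  then obtain b where b: "E v b" "E a b" unfolding thick_def by blast
  have "b \<noteq> a" using b irrE by blast
  let ?M = "V - nbhd v - nbhd b"
  have ind: "\<not> E u w" if "E v u" "E v w" "u \<noteq> a" "w \<noteq> a" for u w
    using thick_indep[OF va] that by blast
  have "shallow ?M"
  proof (rule shallowI[of _ v])
    show "v \<in> V" "v \<notin> ?M" using b symE inV unfolding nbhd_def by blast+
    fix p q assume pq: "p \<notin> ?M" "q \<in> ?M" "E p q"
    have "q \<noteq> v" using pq b symE unfolding nbhd_def by blast
    \<comment> \<open>The neighbours of \<open>a\<close> are \<open>v\<close> and neighbours of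
      \<open>v\<close>, so none is in \<open>M\<close>.\<close>
    then have "p \<noteq> a" using pq thick_twin[OF thick_sym[OF va], of q] unfolding nbhd_def by blast
    have "E v p \<or> E b p" using pq inV[of p q] unfolding nbhd_def by blast
    then show "\<exists>t1 t2. E t1 p \<and> E t2 t1 \<and> \<not> E t2 p \<and> (\<forall>m\<in>?M. \<not> E t1 m \<and> \<not> E t2 m)"
    proof
      assume "E v p"
      then have "E v p \<and> E b v \<and> \<not> E b p \<and> (\<forall>m\<in>?M. \<not> E v m \<and> \<not> E b m)"
        using ind[of b p] b \<open>p \<noteq> a\<close> \<open>b \<noteq> a\<close> E_commute[of v b] unfolding nbhd_def by blast
      then show ?thesis by blast
    next
      assume "E b p"
      then have "E b p \<and> E v b \<and> \<not> E v p \<and> (\<forall>m\<in>?M. \<not> E b m \<and> \<not> E v m)"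
        using ind[of b p] b \<open>p \<noteq> a\<close> \<open>b \<noteq> a\<close> E_commute[of v b] unfolding nbhd_def by blast
      then show ?thesis by blast
    qed
  qed auto
  then have "col ?M 3" by (rule shallow_col3)
  moreover have "indep (nbhd v - {a})" using ind unfolding indep_def nbhd_def by blast
  then have "col (nbhd v - {a}) 1" by (rule col_indep)
  then have "col (nbhd v - {a} \<union> nbhd b) 3" using col_Un[OF _ col_nbhd, of "nbhd v - {a}" 1 b] by (simp add: numeral_3_eq_3)
  moreover have "V \<subseteq> ?M \<union> (nbhd v - {a} \<union> nbhd b)" using b symE unfolding nbhd_def by blast
  ultimately show False using col_cover[of ?M 3 "nbhd v - {a} \<union> nbhd b" 3 6] not6 by auto
qed

lemma one_common: "E u v \<Longrightarrow> E u x \<Longrightarrow> E v x \<Longrightarrow> E u y \<Longrightarrow> E v y \<Longrightarrow> x = y"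
  using nonthick_unique not_thick by blast

end


section \<open>Vertices around a triangle\<close>

locale min_graph_triangle = min_graph +
  fixes x y z T M
  assumes xyz: "E x y" "E y z" "E x z" and T: "T = {x, y, z}" and M: "M = V - nbhd x - nbhd y - nbhd z"
begin

definition row :: "'a \<Rightarrow> 'a set" where "row t = nbhd t - T"

lemma T_adj: "t \<in> T \<Longrightarrow> t' \<in> T \<Longrightarrow> t \<noteq> t' \<Longrightarrow> E t t'"
  using xyz T E_commute[of x] E_commute[of y z] by auto

lemma T_third:
  assumes "t \<in> T" "t' \<in> T"
  obtains t'' where "t'' \<in> T" "t'' \<noteq> t" "t'' \<noteq> t'"
  using assms T xyz irrE by (metis insertCI insertE singletonD)

lemma T_V: "T \<subseteq> V"
  using T xyz inV inV2 by blast

lemma row_E: "p \<in> row t \<Longrightarrow> E t p" and row_T: "p \<in> row t \<Longrightarrow> p \<notin> T" and row_V: "row t \<subseteq> V"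
  unfolding row_def nbhd_def using inV2 by auto

lemma row_other:
  assumes "t \<in> T" "t' \<in> T" "t \<noteq> t'" "p \<in> row t"
  shows "\<not> E t' p"
proof
  assume a: "E t' p"
  obtain t'' where t'': "t'' \<in> T" "t'' \<noteq> t" "t'' \<noteq> t'" using T_third assms by blast
  have "p = t''"
    by (rule one_common[of t t']) (use T_adj assms t'' row_E a in auto)
  then show False using t'' row_T assms by blast
qed

lemma row_disj: "t \<in> T \<Longrightarrow> t' \<in> T \<Longrightarrow> p \<in> row t \<Longrightarrow> p \<in> row t' \<Longrightarrow> t = t'"
  using row_other row_E by blast

lemma M_T: "t \<in> T \<Longrightarrow> m \<in> M \<Longrightarrow> \<not> E t m"
  using T M unfolding nbhd_def by auto

lemma M_V: "M \<subseteq> V" using M by auto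

lemma T_M: "t \<in> T \<Longrightarrow> t \<notin> M"
  using M_T T_adj T_third E_commute by metis

lemma row_M: "t \<in> T \<Longrightarrow> p \<in> row t \<Longrightarrow> p \<notin> M"
  using M_T row_E by blast

lemma V_cases:
  assumes "v \<in> V"
  obtains "v \<in> M" | "v \<in> T" | t where "t \<in> T" "v \<in> row t"
  using assms M T unfolding row_def by blast

lemma V_cover: "V \<subseteq> M \<union> T \<union> (\<Union>t\<in>T. row t)"
  using V_cases by blast

lemma noadj: "E u w \<Longrightarrow> E v w \<Longrightarrow> E u w' \<Longrightarrow> E v w' \<Longrightarrow> w \<noteq> w' \<Longrightarrow> \<not> E u v"
  using one_common by blast

lemma row_col2: "col (row t) 2"
  using col_mono[OF col_nbhd] unfolding row_def by blast

lemma col_T_row: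
  assumes "t \<in> T" "t' \<in> T" "t \<noteq> t'"
  shows "col (row t \<union> {t'}) 2"
  by (rule col_anticomplete[OF row_col2])
    (use row_other[OF assms] E_commute col_mono[OF col_indep[of "{t'}"], of _ 2] irrE in \<open>auto simp: indep_def\<close>)

lemma row_attached:
  assumes "p \<notin> M" "m \<in> M" "E p m"
  obtains t where "t \<in> T" "p \<in> row t"
  using V_cases[of p] assms M_T inV[of p m] by blast

lemma shallow_M: "shallow M"
proof (rule shallowI[of _ x])
  show "x \<in> V" "x \<notin> M" using T T_V T_M by auto
  fix p q assume pq: "p \<notin> M" "q \<in> M" "E p q"
  then obtain t where t: "t \<in> T" "p \<in> row t" using row_attached by blast
  obtain t' where t': "t' \<in> T" "t' \<noteq> t" using T_third t by blast
  show "\<exists>t1 t2. E t1 p \<and> E t2 t1 \<and> \<not> E t2 p \<and> (\<forall>m\<in>M. \<not> E t1 m \<and> \<not> E t2 m)"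
    using row_E[OF t(2)] T_adj[of t' t] t t' row_other[of t t' p] M_T by metis
qed (rule M_V)

lemma M_col3: "col M 3"
  by (rule shallow_col3[OF shallow_M])

lemma T_col3: "col T 3"
proof -
  have "col ({x} \<union> ({y} \<union> {z})) (1 + (1 + 1))"
    by (intro col_Un col_indep) (auto simp: indep_def irrE)
  then show ?thesis using T by (simp add: insert_commute numeral_eq_Suc)
qed

lemma TM_col3: "col (T \<union> M) 3"
  by (rule col_anticomplete[OF T_col3 M_col3]) (rule M_T)

section \<open>Color budget of the rows\<close>

lemma rows_not_col3: "\<not> col (\<Union>t\<in>T. row t) 3"
proof
  assume "col (\<Union>t\<in>T. row t) 3"
  then have "col V 6" using col_cover[OF TM_col3, of "\<Union>t\<in>T. row t" 3 6] V_cover by auto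
  then show False using not6 by simp
qed

lemma rows_split:
  assumes "t \<in> T" "col (\<Union>t'\<in>T - {t}. row t') i" "col (row t) j"
  shows "col (\<Union>t\<in>T. row t) (i + j)"
  by (rule col_mono[OF col_Un[OF assms(2,3)]]) auto

text \<open>One color for the other rows and two for row \<open>t\<close> would be a
  3-coloring.\<close>

lemma others_not_indep: "t \<in> T \<Longrightarrow> \<not> indep (\<Union>t'\<in>T - {t}. row t')"
  using rows_split[OF _ col_indep row_col2] rows_not_col3 by (metis one_plus_numeral semiring_norm(3))

lemma col_rows_indep:
  assumes "\<And>t. t \<in> T \<Longrightarrow> indep (row t - D)"
  shows "col ((\<Union>t\<in>T. row t) - D) 3"
proof -
  have "col ((row x - D) \<union> ((row y - D) \<union> (row z - D))) (1 + (1 + 1))"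
    by (intro col_Un col_indep assms) (auto simp: T)
  then show ?thesis by (rule col_mono) (auto simp: T)
qed

text \<open>Otherwise there is an induced P6. If \<open>p\<close> sees \<open>qb\<close>, it leads
  from \<open>c\<close> along the edge of \<open>M\<close> to \<open>p\<close> and on to two
  triangle vertices; if not, from \<open>p\<close> through two triangle vertices to \<open>c\<close>
  and into \<open>M\<close>.\<close>

lemma trace_adj:
  assumes t: "t \<in> T" "t' \<in> T" "t \<noteq> t'" and p: "p \<in> row t" and c: "c \<in> row t'"
    and q: "qa \<in> M" "qb \<in> M" "E qa qb" and ca: "E c qa" "\<not> E c qb" and pa: "\<not> E p qa"
  shows "E p c"
proof (rule ccontr)
  assume pc: "\<not> E p c"
  obtain t'' where t'': "t'' \<in> T" "t'' \<noteq> t" "t'' \<noteq> t'" using T_third t by blast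
  have f: "E t p" "E t' c" "E t t'" "E t'' t" "E t'' t'" "\<not> E t' p" "\<not> E t c" "\<not> E t'' p" "\<not> E t'' c"
    using row_E[OF p] row_E[OF c] T_adj t t'' row_other[OF t p] row_other[OF t(2,1) _ c] t(3)
      row_other[OF t(1) t''(1) _ p] row_other[OF t(2) t''(1) _ c] by auto
  have g: "\<not> E t qa" "\<not> E t qb" "\<not> E t' qa" "\<not> E t' qb" "\<not> E t'' qa" "\<not> E t'' qb"
    using M_T t t'' q by auto
  show False
  proof (cases "E p qb")
    case True
    show False
      by (rule P6[of t'' t p qb qa c]) (use f g pc ca pa q True E_commute in blast)+
  next
    case False
    show False
      by (rule P6[of p t t' c qa qb]) (use f g pc ca pa q False E_commute in blast)+
  qed
qed

text \<open>A vertex outside \<open>M\<close> sees at most one vertex of the triangle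
  \<open>K\<close>. Some row has an edge, since the rows are not 3-colorable, and both its ends miss
  some \<open>k\<close> in \<open>K\<close>. A vertex of another row that sees \<open>k\<close>
  would be, besides \<open>t\<close>, a common neighbour of these ends. So \<open>k\<close> is
  attached to row \<open>t\<close> only; two of its neighbours there see all of the other rows,
  which are then independent.\<close>

lemma no_tri: "\<not> isolated_triangle M r s n"
proof
  assume isolated_triangle: "isolated_triangle M r s n"
  define K where "K = {r, s, n}"
  have KM: "K \<subseteq> M" using isolated_triangle unfolding K_def isolated_triangle_def by blast
  have Kadj: "E k k'" if "k \<in> K" "k' \<in> K" "k \<noteq> k'" for k k'
    using that isolated_triangle E_commute unfolding K_def isolated_triangle_def by blast
  have Kone: "k = k'" if "k \<in> K" "k' \<in> K" "E p k" "E p k'" "p \<notin> M" for k k' p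
  proof (rule ccontr)
    assume ne: "k \<noteq> k'"
    obtain k'' where "k'' \<in> K" "k'' \<noteq> k" "k'' \<noteq> k'"
      using that ne isolated_triangle irrE unfolding K_def isolated_triangle_def by (metis insertCI insertE singletonD)
    then have "p = k''"
      by (intro one_common[of k k' p k'']) (use that ne Kadj E_commute[of p] in auto)
    then show False using \<open>k'' \<in> K\<close> KM that by blast
  qed
  have Kadj_out: "\<exists>p1 p2. p1 \<noteq> p2 \<and> p1 \<notin> M \<and> p2 \<notin> M \<and> E p1 k \<and> E p2 k" if k: "k \<in> K" for k
  proof (rule ccontr)
    assume neg: "\<not> ?thesis"
    obtain p where p: "\<And>u. u \<notin> M \<Longrightarrow> E u k \<Longrightarrow> u = p" using neg by blast
    have "nbhd k \<subseteq> {r, s, n, p}"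
    proof
      fix u assume "u \<in> nbhd k"
      then have "E k u" "E u k" using E_commute unfolding nbhd_def by auto
      then show "u \<in> {r, s, n, p}"
        using p[of u] k isolated_triangle unfolding K_def isolated_triangle_def by (cases "u \<in> M") auto
    qed
    then have "card (nbhd k) \<le> card {r, s, n, p}" by (intro card_mono) auto
    also have "\<dots> \<le> 4" by (simp add: card_insert_if)
    finally show False using nbhd_card[of k] k KM M_V by fastforce
  qed
  have cross: "E w v" if "t \<in> T" "t' \<in> T" "t \<noteq> t'" "v \<in> row t" "w \<in> row t'" "k \<in> K" "E v k" "\<not> E w k" for t t' v w k
  proof -
    obtain k' where k': "k' \<in> K" "k' \<noteq> k"
      using that isolated_triangle irrE unfolding K_def isolated_triangle_def by (metis insertCI)
    then have "\<not> E v k'" using Kone[of k k' v] that row_M by blast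
    then show ?thesis
      using trace_adj[of t' t w v k k'] that k' Kadj[of k k'] KM by auto
  qed
  obtain t where t: "t \<in> T" "\<not> indep (row t)"
    using col_rows_indep[of "{}"] rows_not_col3 by fastforce
  then obtain u u' where u: "u \<in> row t" "u' \<in> row t" "E u u'" unfolding indep_def by blast
  have uM: "u \<notin> M" "u' \<notin> M" using row_M t u by auto
  obtain k where k: "k \<in> K" "\<not> E u k" "\<not> E u' k"
  proof -
    have rsn: "r \<noteq> s" "r \<noteq> n" "s \<noteq> n" "r \<in> K" "s \<in> K" "n \<in> K"
      using isolated_triangle irrE unfolding K_def isolated_triangle_def by blast+
    show thesis
      using Kone[of r s u] Kone[of r n u] Kone[of s n u] Kone[of r s u'] Kone[of r n u'] Kone[of s n u']
        rsn uM that by blast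
  qed
  let ?R = "\<Union>t'\<in>T - {t}. row t'"
  have Rk: "\<not> E w k" if w: "w \<in> ?R" for w
  proof
    assume wk: "E w k"
    obtain t' where t': "t' \<in> T" "t' \<noteq> t" "w \<in> row t'" using w by blast
    then have "E u w" "E u' w" using cross[of t' t w _ k] wk k u t by auto
    then show False
      using noadj[of u t u' w] row_E[OF u(1)] row_E[OF u(2)] E_commute u(3) t' t row_T by metis
  qed
  obtain p1 p2 where p: "p1 \<noteq> p2" "p1 \<notin> M" "p2 \<notin> M" "E p1 k" "E p2 k" using Kadj_out k by blast
  have in_row: "p \<in> row t" if pk: "p \<notin> M" "E p k" for p
  proof -
    have "k \<in> M" using k KM by blast
    then obtain t1 where "t1 \<in> T" "p \<in> row t1" by (rule row_attached[OF pk(1) _ pk(2)])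
    then show ?thesis using Rk[of p] that by (cases "t1 = t") auto
  qed
  have adj: "E w p" if w: "w \<in> ?R" and p: "p \<notin> M" "E p k" for w p
  proof -
    obtain t' where "t' \<in> T" "t \<noteq> t'" "w \<in> row t'" using w by blast
    then show ?thesis using cross[of t t' p w k] t in_row[OF p] k p Rk[OF w] by blast
  qed
  have "indep ?R"
  proof (rule indepI)
    fix v w assume "v \<in> ?R" "w \<in> ?R" "E v w"
    then show False using noadj[of v p1 w p2] adj p by blast
  qed
  then show False using others_not_indep t by blast
qed

lemma all_cover: "q \<in> M \<Longrightarrow> covers M (component M q)"
  using tri_cases[OF shallow_M, of q] no_tri by blast

lemma cover_edge:
  assumes "q1 \<in> M" "q2 \<in> M" "E q1 q2" "p \<notin> M" "m \<in> component M q1" "E p m"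
  shows "E p q1 \<or> E p q2"
  using all_cover[OF assms(1)] component_refl component_step[OF component_refl assms(1,2,3)] assms(3-6) not_thick
  unfolding covers_def[OF shallow_M assms(1) refl] by blast


section \<open>Traces of the rows on an edge of \<open>M\<close>\<close>

lemma trace_adj':
  assumes "t \<in> T" "t' \<in> T" "t \<noteq> t'" "p \<in> row t" "c \<in> row t'" "q1 \<in> M" "q2 \<in> M" "E q1 q2"
    and "E p q1 \<noteq> E c q1 \<or> E p q2 \<noteq> E c q2" "\<not> (E p q1 \<and> E p q2)" "\<not> (E c q1 \<and> E c q2)"
  shows "E p c"
  using trace_adj[OF assms(1-7,8)] trace_adj[OF assms(1-5,7,6)]
    trace_adj[OF assms(2,1) _ assms(5,4,6-8)] trace_adj[OF assms(2,1) _ assms(5,4,7,6)]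
    assms(3,8-11) E_commute[of q1 q2] E_commute[of p c] by blast

text \<open>The component takes three colors, so at least four vertices are attached, and at most
  one sees both \<open>q1\<close> and \<open>q2\<close>. Two of the others see all of the other
  rows, which have no neighbour in the component; these rows would be independent.\<close>

lemma one_row_no_edge:
  assumes q: "q1 \<in> M" "q2 \<in> M" "E q1 q2" and t: "t \<in> T"
    and att: "\<And>p m. p \<notin> M \<Longrightarrow> m \<in> component M q1 \<Longrightarrow> E p m \<Longrightarrow> p \<in> row t"
  shows False
proof -
  let ?Q = "component M q1" and ?R = "\<Union>t'\<in>T - {t}. row t'"
  define S where "S = {p. p \<notin> M \<and> (\<exists>m\<in>?Q. E p m)}"
  have QM: "?Q \<subseteq> M" by (rule component_subset[OF q(1)])
  have fin: "finite S" using finV inV unfolding S_def by (auto intro: rev_finite_subset)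
  have qQ: "q1 \<in> ?Q" "q2 \<in> ?Q" using component_refl component_step q by blast+
  have "\<not> card S \<le> 3"
  proof
    assume c: "card S \<le> 3"
    show False
    proof (rule extend_cut[OF _ _ _ fin c col_mono[OF M_col3 QM]])
      show "?Q \<subseteq> V" "?Q \<noteq> {}" using QM M_V qQ by auto
      show "u \<in> S" if "u \<in> V - ?Q" "v \<in> ?Q" "E u v" for u v
        using that component_step[of v M q1 u] q E_commute unfolding S_def by blast
    qed auto
  qed
  define S' where "S' = {p\<in>S. \<not> (E p q1 \<and> E p q2)}"
  have "\<exists>p1 p2. p1 \<in> S' \<and> p2 \<in> S' \<and> p1 \<noteq> p2"
  proof (rule ccontr)
    assume neg: "\<not> ?thesis"
    obtain a where a: "S' \<subseteq> {a}" using neg by blast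
    obtain b where b: "S - S' \<subseteq> {b}"
      using one_common[OF q(3)] E_commute unfolding S'_def by blast
    have "S \<subseteq> {a, b}" using a b by blast
    then have "card S \<le> card {a, b}" by (intro card_mono) auto
    also have "\<dots> \<le> 2" by (simp add: card_insert_if)
    finally show False using \<open>\<not> card S \<le> 3\<close> by simp
  qed
  then obtain p1 p2 where p: "p1 \<in> S'" "p2 \<in> S'" "p1 \<noteq> p2" by blast
  have adj: "E w p" if w: "w \<in> ?R" and pS: "p \<in> S'" for w p
  proof -
    obtain t' where t': "t' \<in> T" "t' \<noteq> t" "w \<in> row t'" using w by blast
    have pt: "p \<notin> M" "p \<in> row t" "E p q1 \<or> E p q2" "\<not> (E p q1 \<and> E p q2)"
      using pS att cover_edge[OF q] unfolding S'_def S_def by blast+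
    have "\<not> E w m" if "m \<in> ?Q" for m
      using att[of w m] that t' row_M row_disj t by blast
    then show ?thesis
      using trace_adj'[OF t'(1) t t'(2,3) pt(2) q] pt qQ by blast
  qed
  have "indep ?R"
  proof (rule indepI)
    fix v w assume "v \<in> ?R" "w \<in> ?R" "E v w"
    then show False using noadj[of v p1 w p2] adj p by blast
  qed
  then show False using others_not_indep t by blast
qed

text \<open>If \<open>c\<close> sees \<open>d\<close>, the sides are the neighbours and the
  non-neighbours of \<open>d\<close>: in an edge seen by \<open>d\<close>, some end is seen by
  \<open>c\<close>, and \<open>d\<close> and this end would share \<open>c\<close> and the other
  end. If not, one side consists of the vertices seen by both, since different traces on an edge
  would make \<open>c\<close> and \<open>d\<close> adjacent.\<close>

lemma two_rows_bipartite:
  assumes q: "q \<in> M" and t: "t \<in> T" "t' \<in> T" "t \<noteq> t'" and c: "c \<in> row t" "m \<in> component M q" "E c m"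
    and d: "d \<in> row t'" "m' \<in> component M q" "E d m'"
  shows "col (component M q) 2"
proof -
  let ?Q = "component M q"
  have QM: "?Q \<subseteq> M" by (rule component_subset[OF q])
  have cdM: "c \<notin> M" "d \<notin> M" using row_M c d t by auto
  have cov: "E c u \<or> E c w" "E d u \<or> E d w" if "u \<in> ?Q" "w \<in> ?Q" "E u w" for u w
  proof -
    have "component M u = ?Q" using component_eq that by blast
    then show "E c u \<or> E c w" "E d u \<or> E d w"
      using cover_edge[of u w c m] cover_edge[of u w d m'] that QM cdM c d by auto
  qed
  have cd: "c \<noteq> d" using c d row_disj t by blast
  show ?thesis
  proof (cases "E c d")
    case True
    have i1: "indep {u\<in>?Q. E d u}"
    proof (rule indepI)
      have *: False if "a \<in> ?Q" "b \<in> ?Q" "E d a" "E d b" "E a b" "E c a" for a b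
      proof -
        have "c = b" by (rule one_common[of d a]) (use that True E_commute in blast)+
        then show False using that cdM QM by blast
      qed
      fix a b assume "a \<in> {u\<in>?Q. E d u}" "b \<in> {u\<in>?Q. E d u}" "E a b"
      then show False using *[of a b] *[of b a] cov(1)[of a b] E_commute[of a b] by blast
    qed
    have i2: "indep {u\<in>?Q. \<not> E d u}" using cov(2) unfolding indep_def by blast
    show ?thesis by (rule col_mono[OF col_indep_Un[OF i1 i2]]) auto
  next
    case False
    have i1: "indep {u\<in>?Q. E c u \<and> E d u}"
      using noadj[of _ c _ d] cd E_commute[of c] E_commute[of d] unfolding indep_def by blast
    have i2: "indep {u\<in>?Q. \<not> (E c u \<and> E d u)}"
    proof (rule indepI)
      fix a b assume ab: "a \<in> {u\<in>?Q. \<not> (E c u \<and> E d u)}" "b \<in> {u\<in>?Q. \<not> (E c u \<and> E d u)}" "E a b"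
      then have "a \<in> M" "b \<in> M" using QM by auto
      then show False
        using trace_adj'[OF t c(1) d(1) _ _ ab(3)] cov[of a b] ab False by blast
    qed
    show ?thesis by (rule col_mono[OF col_indep_Un[OF i1 i2]]) auto
  qed
qed

lemma component_col2:
  assumes q: "q \<in> M"
  shows "col (component M q) 2"
proof (cases "indep (component M q)")
  case True
  then show ?thesis using col_mono[OF col_indep] by fastforce
next
  case False
  then obtain a b where ab: "a \<in> component M q" "b \<in> component M q" "E a b" unfolding indep_def by blast
  have ce: "component M a = component M q" using component_eq[OF ab(1)] .
  have abM: "a \<in> M" "b \<in> M" using ab component_subset[OF q] by auto
  obtain p m where p: "p \<notin> M" "m \<in> component M q" "E p m" using attached[OF shallow_M q refl] by metis
  then obtain t where t: "t \<in> T" "p \<in> row t" using row_attached component_subset[OF q] by blast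
  obtain p' m' where p': "p' \<notin> M" "m' \<in> component M q" "E p' m'" "p' \<notin> row t"
    using one_row_no_edge[OF abM ab(3) t(1)] ce by metis
  then obtain t' where t': "t' \<in> T" "p' \<in> row t'" using row_attached component_subset[OF q] by blast
  then have "t \<noteq> t'" using p' by auto
  then show ?thesis using two_rows_bipartite[OF q t(1) t'(1) _ t(2) p(2,3) t'(2) p'(2,3)] by blast
qed

lemma M_col2: "col M 2"
  by (rule col_components[OF component_col2])

text \<open>The other two triangle vertices reuse the two colors of \<open>M\<close>, where they
  have no neighbours.\<close>

lemma rows_plus_not_col4:
  assumes "t \<in> T" "col ((\<Union>t\<in>T. row t) \<union> {t}) 4"
  shows False
proof -
  have "\<exists>a b. T - {t} \<subseteq> {a} \<union> {b}" using assms T by auto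
  then obtain a b where "T - {t} \<subseteq> {a} \<union> {b}" by blast
  moreover have "col ({a} \<union> {b}) 2" by (intro col_indep_Un) (auto simp: indep_def irrE)
  ultimately have "col (T - {t}) 2" using col_mono by blast
  then have "col (T - {t} \<union> M) 2" using M_col2 M_T by (intro col_anticomplete) auto
  then have "col V 6" using col_cover[OF assms(2), of "T - {t} \<union> M" 2 6] V_cover by auto
  then show False using not6 by simp
qed



section \<open>Excluding edges in \<open>M\<close>\<close>

lemma indep_insert_other: "t \<in> T \<Longrightarrow> t' \<in> T \<Longrightarrow> t \<noteq> t' \<Longrightarrow> A \<subseteq> row t \<Longrightarrow> indep A \<Longrightarrow> indep (A \<union> {t'})"
  using row_other[of t t'] E_commute[of t'] irrE unfolding indep_def by blast

lemma both_unique: "E q1 q2 \<Longrightarrow> E d q1 \<Longrightarrow> E d q2 \<Longrightarrow> E d' q1 \<Longrightarrow> E d' q2 \<Longrightarrow> d = d'"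
  using one_common[of q1 q2 d d'] E_commute[of d] E_commute[of d'] by blast

lemma both_not_adj:
  assumes "q1 \<in> M" "q2 \<in> M" "E q1 q2" "E d q1" "E d q2" "w \<notin> M" "E w q1 \<or> E w q2"
  shows "\<not> E d w"
proof
  assume "E d w"
  then have "w = q2 \<or> w = q1"
    using one_common[of d q1 w q2] one_common[of d q2 w q1] assms E_commute by metis
  then show False using assms by blast
qed

text \<open>Each of the next cases colors the rows together with one vertex \<open>t'\<close> of \<open>T\<close> by four colors; the
  other two vertices of \<open>T\<close> can be colored like \<open>M\<close>.\<close>

lemma same_trace_pair:
  assumes k: "k \<in> M" "k' \<in> M" "E k k'" and t: "t \<in> T"
    and p: "p1 \<in> row t" "p2 \<in> row t" "p1 \<noteq> p2" "E p1 k" "E p2 k" "\<not> E p1 k'" "\<not> E p2 k'"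
  shows False
proof -
  let ?R = "\<Union>t'\<in>T - {t}. row t'" and ?N = "\<Union>t\<in>T. row t"
  obtain t' where t': "t' \<in> T" "t \<noteq> t'" using T_third t by metis
  define D where "D = {v\<in>?N. E v k \<and> E v k'}"
  define \<alpha> where "\<alpha> = {w\<in>?R. \<not> E w k}"
  define \<beta> where "\<beta> = {w\<in>?R. E w k \<and> \<not> E w k'}"
  have NM: "v \<notin> M" if "v \<in> ?N" for v using that row_M by blast
  have adj: "E w p1 \<and> E w p2" if w: "w \<in> \<alpha>" for w
  proof -
    obtain s where s: "s \<in> T" "s \<noteq> t" "w \<in> row s" "\<not> E w k"
      using w unfolding \<alpha>_def by blast
    show ?thesis
      using trace_adj[OF s(1) t s(2,3) p(1) k p(4,6) s(4)] trace_adj[OF s(1) t s(2,3) p(2) k p(5,7) s(4)] by blast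
  qed
  have ia: "indep \<alpha>"
  proof (rule indepI)
    fix v w assume "v \<in> \<alpha>" "w \<in> \<alpha>" "E v w"
    then show False using noadj[of v p1 w p2] adj p(3) by blast
  qed
  show False
  \<comment> \<open>If \<beta> is independent, the classes are \<alpha>, \<beta> with
    \<open>D\<close>, and the two of row \<open>t\<close>, which also admit
    \<open>t'\<close>.\<close>
  proof (cases "indep \<beta>")
    case True
    have "indep (\<beta> \<union> D)"
    proof (rule indepI)
      have d: "\<not> E v w" if "v \<in> D" "w \<in> \<beta> \<union> D" for v w
        by (rule both_not_adj[OF k]) (use that NM in \<open>auto simp: D_def \<beta>_def\<close>)
      fix v w assume "v \<in> \<beta> \<union> D" "w \<in> \<beta> \<union> D" "E v w"
      then show False using d[of v w] d[of w v] E_commute[of v w] True unfolding indep_def by blast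
    qed
    then have "col (\<alpha> \<union> (\<beta> \<union> D) \<union> (row t \<union> {t'})) (2 + 2)"
      using col_indep_Un[OF ia] col_T_row[OF t t'] by (intro col_Un)
    moreover have "?N \<union> {t'} \<subseteq> \<alpha> \<union> (\<beta> \<union> D) \<union> (row t \<union> {t'})"
      unfolding \<alpha>_def \<beta>_def D_def using t by blast
    ultimately have "col (?N \<union> {t'}) 4" by (rule col_mono) simp
    then show False using rows_plus_not_col4 t' by blast
  next
    case False
    then obtain a b where ab: "a \<in> \<beta>" "b \<in> \<beta>" "E a b" unfolding indep_def by blast
    \<comment> \<open>The ends of an edge in \<beta> share \<open>k\<close>, and a vertex of row
      \<open>t\<close> that missed \<open>k\<close> would see both ends. Once all of row
      \<open>t\<close> sees \<open>k\<close>, it is independent, and \<beta> and \<open>D\<close> go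
      into the neighbourhood of \<open>k\<close>.\<close>
    have only_k: "E v k" if v: "v \<in> row t" for v
    proof (rule ccontr)
      assume nk: "\<not> E v k"
      have "E v w" if w: "w \<in> \<beta>" for w
      proof -
        obtain s where s: "s \<in> T" "s \<noteq> t" "w \<in> row s" "E w k" "\<not> E w k'"
          using w unfolding \<beta>_def by blast
        show ?thesis using trace_adj[OF t s(1) _ v s(3) k s(4,5) nk] s(2) by blast
      qed
      then have "E a v" "E b v" using ab E_commute by blast+
      moreover have "v \<noteq> k" using row_M[OF t v] k by blast
      ultimately show False using noadj[of a v b k] ab unfolding \<beta>_def by blast
    qed
    have "indep (row t)"
    proof (rule indepI)
      fix u v assume "u \<in> row t" "v \<in> row t" "E u v"
      then show False
        using noadj[of u t v k] only_k[of u] only_k[of v] row_E[of u t] row_E[of v t]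
          E_commute[of t u] E_commute[of t v] T_M[OF t] k by blast
    qed
    then have "indep (row t \<union> {t'})" using indep_insert_other[OF t t'] by blast
    then have "col (\<alpha> \<union> (row t \<union> {t'}) \<union> nbhd k) (2 + 2)"
      using col_indep_Un[OF ia] col_nbhd by (intro col_Un)
    moreover have "?N \<union> {t'} \<subseteq> \<alpha> \<union> (row t \<union> {t'}) \<union> nbhd k"
      unfolding \<alpha>_def nbhd_def using t E_commute[of k] by blast
    ultimately have "col (?N \<union> {t'}) 4" by (rule col_mono) simp
    then show False using rows_plus_not_col4 t' by blast
  qed
qed


text \<open>Vertices of other rows with the trace of \<open>v\<close> all see \<open>v'\<close> and
  \<open>k\<close>, so they are independent. They miss \<open>v\<close>, because \<open>v\<close>
  and \<open>v'\<close> already share \<open>s\<close>.\<close>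

lemma crossing_column_indep:
  assumes k: "k \<in> M" "k' \<in> M" "E k k'" and s: "s \<in> T" and v: "v \<in> row s" "E v k" "\<not> E v k'"
    and v': "v' \<in> row s" "E v' k'" "\<not> E v' k" and vv': "E v v'"
    and uniq: "\<And>r a b. r \<in> T \<Longrightarrow> a \<in> row r \<Longrightarrow> b \<in> row r \<Longrightarrow> E a k \<Longrightarrow> E b k \<Longrightarrow> \<not> E a k' \<Longrightarrow> \<not> E b k' \<Longrightarrow> a = b"
  shows "indep {a \<in> (\<Union>t\<in>T. row t). E a k \<and> \<not> E a k'}"
proof (rule indepI)
  have x: "E b v'" if "b \<in> row r" "r \<in> T" "r \<noteq> s" "E b k" "\<not> E b k'" for b r
    using trace_adj'[OF that(2) s that(3,1) v'(1) k] v' that by blast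
  have y: "\<not> E b v" if "b \<in> row r" "r \<in> T" "r \<noteq> s" "E b k" "\<not> E b k'" for b r
    using noadj[of v s v' b] x[OF that] E_commute[of s v] E_commute[of s v'] E_commute[of b] row_E[OF v(1)] row_E[OF v'(1)]
      vv' row_T[OF that(1)] s by blast
  fix a b assume "a \<in> {a \<in> (\<Union>t\<in>T. row t). E a k \<and> \<not> E a k'}" "b \<in> {a \<in> (\<Union>t\<in>T. row t). E a k \<and> \<not> E a k'}"
    and ab: "E a b"
  then obtain ra rb where a: "a \<in> row ra" "ra \<in> T" "E a k" "\<not> E a k'" and b: "b \<in> row rb" "rb \<in> T" "E b k" "\<not> E b k'"
    by blast
  show False
  proof (cases "ra = s \<or> rb = s")
    case True
    then have "a = v \<or> b = v" using uniq[OF s] a b v by blast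
    moreover have "a \<noteq> b" using ab irrE by blast
    then have "ra \<noteq> rb" using uniq[of ra a b] a b by blast
    ultimately show False
      using y[of b rb] y[of a ra] a b ab E_commute[of a b] True uniq[OF s, of a v] uniq[OF s, of b v] v by blast
  next
    case False
    then have "E a v'" "E b v'" using x a b by blast+
    moreover have "v' \<noteq> k" using row_M[OF s v'(1)] k by blast
    ultimately show False using noadj[of a v' b k] a b ab by blast
  qed
qed

text \<open>Row vertices are sorted by their trace on an edge of \<open>M\<close>. At least four see
  exactly one end, so some row \<open>t\<close> contains two of these, one for each end by
  \<open>same_trace_pair\<close>. The remaining cases depend on the traces of adjacent vertices
  within a row.\<close>

lemma M_indep: "indep M"
proof (rule indepI)
  fix q1 q2 assume q: "q1 \<in> M" "q2 \<in> M" "E q1 q2"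
  note q' = q(2,1) symE[OF q(3)]
  let ?N = "\<Union>t\<in>T. row t"
  define D where "D = {v\<in>?N. E v q1 \<and> E v q2}"
  define S where "S = {v\<in>?N. E v q1 \<noteq> E v q2}"
  have NM: "v \<notin> M" if "v \<in> ?N" for v using that row_M by blast
  have NV: "?N \<subseteq> V" using row_V by blast
  have finS: "finite S" "finite D" using finV NV unfolding S_def D_def by (auto intro: rev_finite_subset)
  obtain d where d: "D \<subseteq> {d}" using both_unique[OF q(3)] unfolding D_def by blast
  have iD: "indep D" using d irrE unfolding indep_def by blast
  have DS: "\<not> E a b" if "a \<in> D" "b \<in> S" for a b
    using both_not_adj[OF q, of a b] that NM unfolding D_def S_def by blast
  \<comment> \<open>The component takes two colors, so a cut of four vertices would let a coloring
    extend; \<open>D\<close> contributes at most one.\<close>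
  have cardS: "4 \<le> card S"
  proof (rule ccontr)
    assume "\<not> 4 \<le> card S"
    moreover have "card D \<le> 1" using card_mono[OF _ d] by simp
    ultimately have c: "card (S \<union> D) \<le> 4" using card_Un_le[of S D] by linarith
    show False
    proof (rule extend_cut[OF _ _ _ _ c component_col2[OF q(1)]])
      show "component M q1 \<subseteq> V" "component M q1 \<noteq> {}" using component_subset[OF q(1)] M_V component_refl by blast+
      show "finite (S \<union> D)" using finS by simp
      fix u v assume uv: "u \<in> V - component M q1" "v \<in> component M q1" "E u v"
      then have vM: "v \<in> M" using component_subset[OF q(1)] by blast
      have uM: "u \<notin> M" using component_step[OF uv(2) q(1), of u] uv E_commute by blast
      obtain t where "t \<in> T" "u \<in> row t" using row_attached[OF uM vM uv(3)] by blast
      then show "u \<in> S \<union> D"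
        using cover_edge[OF q uM uv(2,3)] unfolding S_def D_def by blast
    qed simp
  qed
  have "\<exists>t\<in>T. \<exists>p1 p2. p1 \<in> S \<inter> row t \<and> p2 \<in> S \<inter> row t \<and> p1 \<noteq> p2"
  proof (rule ccontr)
    assume neg: "\<not> ?thesis"
    have "card (S \<inter> row t) \<le> 1" if "t \<in> T" for t
      using neg that finS by (auto simp: card_le_Suc0_iff_eq)
    moreover have "S = (\<Union>t\<in>T. S \<inter> row t)" unfolding S_def by blast
    moreover have "finite T" "card T \<le> 3" unfolding T by (auto simp: card_insert_if)
    ultimately show False
      using card_UN_le[of T "\<lambda>t. S \<inter> row t"] sum_bounded_above[of T "\<lambda>t. card (S \<inter> row t)" 1] cardS by fastforce
  qed
  then obtain t p1 p2 where t: "t \<in> T" and p: "p1 \<in> S" "p2 \<in> S" "p1 \<in> row t" "p2 \<in> row t" "p1 \<noteq> p2" by blast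
  have uniq1: "a = b" if "r \<in> T" "a \<in> row r" "b \<in> row r" "E a q1" "E b q1" "\<not> E a q2" "\<not> E b q2" for r a b
    using same_trace_pair[OF q that(1-3) _ that(4-7)] by blast
  have uniq2: "a = b" if "r \<in> T" "a \<in> row r" "b \<in> row r" "E a q2" "E b q2" "\<not> E a q1" "\<not> E b q1" for r a b
    using same_trace_pair[OF q' that(1-3) _ that(4-7)] by blast
  obtain c1 c2 where c: "c1 \<in> row t" "c2 \<in> row t" "E c1 q1" "\<not> E c1 q2" "E c2 q2" "\<not> E c2 q1"
    using p uniq1[OF t p(3,4)] uniq2[OF t p(3,4)] unfolding S_def by blast
  have cross: "E v w" if "v \<in> row r" "w \<in> row r'" "r \<in> T" "r' \<in> T" "r \<noteq> r'" "v \<notin> D" "w \<notin> D"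
      "E v q1 \<noteq> E w q1 \<or> E v q2 \<noteq> E w q2" for v w r r'
    using trace_adj'[OF that(3,4,5,1,2) q that(8)] that unfolding D_def by blast
  \<comment> \<open>Row \<open>s\<close> has no vertex of \<open>S\<close> besides \<open>u\<close>
    and \<open>u'\<close>, so another row contains some \<open>w\<close> in \<open>S\<close>. The
    vertices of row \<open>s\<close> with empty trace share \<open>s\<close> and \<open>w\<close>,
    hence are independent; the two columns and \<open>s\<close> complete the four classes. In the
    other rows no trace is empty, as \<open>u\<close> and \<open>u'\<close> would then share a
    second neighbour.\<close>
  have swap: False if s: "s \<in> T" and u: "u \<in> row s" "u' \<in> row s" "E u u'" and
      tr: "E u q1" "\<not> E u q2" "\<not> E u' q1" "E u' q2" for s u u'
  proof -
    let ?C0 = "{v\<in>row s. \<not> E v q1 \<and> \<not> E v q2}"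
    let ?C1 = "{v\<in>?N. E v q1 \<and> \<not> E v q2}" and ?C2 = "{v\<in>?N. E v q2 \<and> \<not> E v q1}"
    have "\<not> S \<subseteq> {u, u'}"
    proof
      assume "S \<subseteq> {u, u'}"
      then have "card S \<le> card {u, u'}" by (intro card_mono) auto
      also have "\<dots> \<le> 2" by (simp add: card_insert_if)
      finally show False using cardS by simp
    qed
    then obtain w where w: "w \<in> S" "w \<noteq> u" "w \<noteq> u'" by blast
    have "w \<notin> row s" using uniq1[OF s, of w u] uniq2[OF s, of w u'] w u tr unfolding S_def by blast
    then obtain r where r: "r \<in> T" "w \<in> row r" "s \<noteq> r" using w unfolding S_def by blast
    have "indep ?C0"
    proof (rule indepI)
      have *: "E v w" if "v \<in> ?C0" for v
        using cross[OF _ r(2) s r(1,3), of v] that w unfolding S_def D_def by blast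
      fix v v' assume "v \<in> ?C0" "v' \<in> ?C0" "E v v'"
      then show False
        using noadj[of v s v' w] *[of v] *[of v'] row_E[of v s] row_E[of v' s] E_commute[of s v] E_commute[of s v']
          row_T[OF r(2)] s by blast
    qed
    moreover have "indep ?C1" by (rule crossing_column_indep[OF q s u(1) tr(1,2) u(2) tr(4,3) u(3) uniq1])
    ultimately have C01: "col (?C0 \<union> ?C1) 2" by (rule col_indep_Un)
    have i2: "indep ?C2"
      by (rule crossing_column_indep[OF q' s u(2) tr(4,3) u(1) tr(1,2) symE[OF u(3)] uniq2])
    have "indep (?C2 \<union> D)"
    proof (rule indepI)
      have CS: "?C2 \<subseteq> S" unfolding S_def by blast
      fix a b assume "a \<in> ?C2 \<union> D" "b \<in> ?C2 \<union> D" "E a b"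
      then show False using i2 iD DS[of a b] DS[of b a] CS E_commute[of a b] unfolding indep_def by blast
    qed
    then have "col (?C2 \<union> D \<union> {s}) 2" by (rule col_indep_Un) (simp add: indep_def irrE)
    then have "col (?C0 \<union> ?C1 \<union> (?C2 \<union> D \<union> {s})) (2 + 2)" by (rule col_Un[OF C01])
    moreover have "?N \<union> {s} \<subseteq> ?C0 \<union> ?C1 \<union> (?C2 \<union> D \<union> {s})"
    proof
      fix v assume "v \<in> ?N \<union> {s}"
      then consider "v = s" | r where "r \<in> T" "v \<in> row r" by blast
      then show "v \<in> ?C0 \<union> ?C1 \<union> (?C2 \<union> D \<union> {s})"
      proof cases
        case 2
        have "v \<in> row s \<or> E v q1 \<or> E v q2"
        proof (rule ccontr)
          assume neg: "\<not> ?thesis"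
          then have "r \<noteq> s" using 2 by blast
          then have "E v u" "E v u'"
            using cross[OF 2(2) u(1) 2(1) s] cross[OF 2(2) u(2) 2(1) s] neg tr unfolding D_def by blast+
          then show False
            using noadj[of u s u' v] E_commute[of v] row_E[OF u(1)] row_E[OF u(2)] E_commute[of s] u(3) row_T[OF 2(2)] s by blast
        qed
        then show ?thesis using 2 unfolding D_def by blast
      qed simp
    qed
    ultimately have "col (?N \<union> {s}) 4" by (rule col_mono) simp
    then show False using rows_plus_not_col4 s by blast
  qed
  show False
  proof (cases "\<forall>s\<in>T. indep (row s - D)")
    case True
    obtain t' where t': "t' \<in> T" "d \<notin> row t'"
    proof (cases "d \<in> row t")
      case True
      obtain t' where "t' \<in> T" "t' \<noteq> t" using T_third t by metis
      then show thesis using that True row_disj t by blast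
    qed (use that t in blast)
    have "indep (D \<union> {t'})"
      using d t' iD irrE E_commute[of t'] unfolding indep_def D_def row_def nbhd_def by blast
    then have "col (?N - D \<union> (D \<union> {t'})) (3 + 1)"
      by (intro col_Un col_rows_indep col_indep) (use True in auto)
    then have "col (?N \<union> {t'}) 4" by (rule col_mono) auto
    then show False using rows_plus_not_col4 t' by blast
  next
    case False
    then obtain s u u' where s: "s \<in> T" and u: "u \<in> row s" "u' \<in> row s" "u \<notin> D" "u' \<notin> D" "E u u'"
      unfolding indep_def by blast
    have tr: "(E w q1 = E u q1 \<and> E w q2 = E u q2) \<or> (E w q1 = E u' q1 \<and> E w q2 = E u' q2)"
      if w: "w \<in> row r" "r \<in> T" "r \<noteq> s" "w \<notin> D" for w r
    proof (rule ccontr)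
      assume "\<not> ?thesis"
      then have "E w u" "E w u'" using cross[OF w(1) _ w(2) s w(3,4)] u by blast+
      then show False
        using noadj[of u s u' w] E_commute[of w] row_E[OF u(1)] row_E[OF u(2)] E_commute[of s] u(5) row_T[OF w(1)] s by blast
    qed
    have no: "\<not> (E u q1 \<and> \<not> E u q2 \<and> \<not> E u' q1 \<and> E u' q2)" "\<not> (E u' q1 \<and> \<not> E u' q2 \<and> \<not> E u q1 \<and> E u q2)"
      using swap[OF s u(1,2,5)] swap[OF s u(2,1) symE[OF u(5)]] by blast+
    have cD: "c1 \<notin> D" "c2 \<notin> D" using c unfolding D_def by blast+
    \<comment> \<open>In a row other than \<open>s\<close> the opposite traces of \<open>c1\<close>
      and \<open>c2\<close> would have to be those of \<open>u\<close> and \<open>u'\<close>, which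
      \<open>no\<close> excludes.\<close>
    have st: "s = t"
    proof (rule ccontr)
      assume "s \<noteq> t"
      then show False using tr[OF c(1) t _ cD(1)] tr[OF c(2) t _ cD(2)] c no by blast
    qed
    let ?R = "\<Union>t'\<in>T - {t}. row t'"
    define \<alpha> where "\<alpha> = {w\<in>?R. \<not> E w q1 \<and> \<not> E w q2}"
    define \<delta> where "\<delta> = {w\<in>?R. E w q1 \<noteq> E w q2}"
    have ia: "indep \<alpha>"
    proof (rule indepI)
      have *: "E w c1 \<and> E w c2" if "w \<in> \<alpha>" for w
        using cross[OF _ c(1) _ t, of w] cross[OF _ c(2) _ t, of w] that cD c unfolding \<alpha>_def D_def by blast
      fix a b assume "a \<in> \<alpha>" "b \<in> \<alpha>" "E a b"
      then show False using noadj[of a c1 b c2] * c by blast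
    qed
    \<comment> \<open>Adjacent vertices of \<delta> would have the same trace, and so share one end
      of the edge of \<open>M\<close> and whichever of \<open>c1\<close>, \<open>c2\<close> has the
      opposite trace.\<close>
    have id: "indep \<delta>"
    proof (rule indepI)
      fix a b assume ab: "a \<in> \<delta>" "b \<in> \<delta>" "E a b"
      then obtain ra rb where r: "a \<in> row ra" "ra \<in> T" "ra \<noteq> t" "b \<in> row rb" "rb \<in> T" "rb \<noteq> t"
        unfolding \<delta>_def by blast
      have abD: "a \<notin> D" "b \<notin> D" using ab unfolding \<delta>_def D_def by blast+
      have same: "E a q1 = E b q1" "E a q1 \<noteq> E a q2" "E b q1 \<noteq> E b q2"
        using tr[OF r(1,2) _ abD(1)] tr[OF r(4,5) _ abD(2)] r st no ab(1,2) unfolding \<delta>_def by blast+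
      have x: "E a c1" "E b c1" if "E a q2"
        using cross[OF r(1) c(1) r(2) t r(3) abD(1) cD(1)] cross[OF r(4) c(1) r(5) t r(6) abD(2) cD(1)] that same c by blast+
      have y: "E a c2" "E b c2" if "E a q1"
        using cross[OF r(1) c(2) r(2) t r(3) abD(1) cD(2)] cross[OF r(4) c(2) r(5) t r(6) abD(2) cD(2)] that same c by blast+
      have "c1 \<noteq> q2" "c2 \<noteq> q1" using row_M[OF t c(1)] row_M[OF t c(2)] q by blast+
      then show False
        using noadj[of a c1 b q2] noadj[of a c2 b q1] x y same ab(3) by blast
    qed
    have "indep (\<delta> \<union> D)"
    proof (rule indepI)
      have CS: "\<delta> \<subseteq> S" unfolding S_def \<delta>_def by blast
      fix a b assume "a \<in> \<delta> \<union> D" "b \<in> \<delta> \<union> D" "E a b"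
      then show False using id iD DS[of a b] DS[of b a] CS E_commute[of a b] unfolding indep_def by blast
    qed
    then have ad: "col (\<alpha> \<union> (\<delta> \<union> D)) 2" by (rule col_indep_Un[OF ia])
    obtain t' where t': "t' \<in> T" "t \<noteq> t'" using T_third t by metis
    have "col (\<alpha> \<union> (\<delta> \<union> D) \<union> (row t \<union> {t'})) (2 + 2)"
      by (rule col_Un[OF ad col_T_row[OF t t']])
    moreover have "?N \<union> {t'} \<subseteq> \<alpha> \<union> (\<delta> \<union> D) \<union> (row t \<union> {t'})"
      unfolding \<alpha>_def \<delta>_def D_def using t by blast
    ultimately have "col (?N \<union> {t'}) 4" by (rule col_mono) simp
    then show False using rows_plus_not_col4 t' by blast
  qed
qed


section \<open>Independent \<open>M\<close>\<close>

lemma mate_dichotomy: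
  assumes "t \<in> T" "t' \<in> T" "t \<noteq> t'" and p: "p \<in> row t" "p' \<in> row t" "E p p'"
    and q: "q \<in> M" "E q p" and a: "a \<in> row t'" "E q a"
  shows "E a p \<or> E a p'"
proof (rule ccontr)
  assume neg: "\<not> ?thesis"
  obtain t'' where t'': "t'' \<in> T" "t'' \<noteq> t" "t'' \<noteq> t'" using T_third assms by blast
  have "\<not> E q p'"
    using one_common[of p p' t q] p q row_E[OF p(1)] row_E[OF p(2)] T_M[OF assms(1)]
      E_commute[of t] E_commute[of q] by blast
  \<comment> \<open>The path runs from \<open>p'\<close> through \<open>p\<close>, \<open>q\<close>
    and \<open>a\<close> into the triangle; \<open>q\<close> misses \<open>p'\<close> because
    \<open>p\<close> and \<open>p'\<close> already share \<open>t\<close>.\<close>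
  then show False
    using P6[of p' p q a t' t''] neg p q a row_E[OF a(1)] T_adj[OF assms(2) t''(1)] t''
      M_T[OF assms(2) q(1)] M_T[OF t''(1) q(1)] row_other[OF assms(1-3) p(1)] row_other[OF assms(1-3) p(2)]
      row_other[OF assms(1) t''(1) _ p(1)] row_other[OF assms(1) t''(1) _ p(2)] row_other[OF assms(2) t''(1) _ a(1)]
      E_commute[of p p'] E_commute[of q p] E_commute[of q p'] E_commute[of a] E_commute[of t'] E_commute[of t'']
    by metis
qed

text \<open>The shape of a class in the final coloring.\<close>

lemma row_class_indep:
  assumes t: "t \<in> T" "t' \<in> T" "t \<noteq> t'" and A: "A \<subseteq> row t" "indep A"
    and N: "N \<subseteq> M" "\<And>m a. m \<in> N \<Longrightarrow> a \<in> A \<Longrightarrow> \<not> E m a"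
  shows "indep (A \<union> N \<union> {t'})"
proof -
  have 1: "indep (A \<union> {t'})" by (rule indep_insert_other[OF t A])
  have 2: "indep N" using indep_subset[OF M_indep N(1)] .
  have 3: "\<not> E m a" if "m \<in> N" "a \<in> A \<union> {t'}" for m a
    using that N M_T[OF t(2)] E_commute[of t' m] by blast
  show ?thesis
  proof (rule indepI)
    fix u v assume "u \<in> A \<union> N \<union> {t'}" "v \<in> A \<union> N \<union> {t'}" "E u v"
    then show False using 1 2 3[of u v] 3[of v u] E_commute[of u v] unfolding indep_def by blast
  qed
qed

text \<open>An edge within the neighbourhood of \<open>q\<close> would join two rows, and its ends
  would share, besides \<open>q\<close>, the mate of a neighbour of \<open>q\<close> in the third
  row. A row vertex that \<open>q\<close> misses sees all neighbours of \<open>q\<close> in one of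
  the other two rows, or P6 appears. Grouped by that row, these vertices share two neighbours, so
  they form three independent sets besides \<open>nbhd q\<close> and \<open>M\<close>.\<close>

lemma rich_vertex_False:
  assumes q: "q \<in> M" and two: "\<And>t. t \<in> T \<Longrightarrow> \<exists>u w. u \<in> row t \<and> w \<in> row t \<and> u \<noteq> w \<and> E q u \<and> E q w"
    and mated: "\<And>t. t \<in> T \<Longrightarrow> \<exists>w\<in>row t. E q w \<and> (\<exists>w'\<in>row t. E w w')"
  shows False
proof -
  have nq: "\<exists>t\<in>T. u \<in> row t" if "E q u" for u
    using V_cases[OF inV2[OF that]] M_indep q that M_T E_commute[of q u] unfolding indep_def by metis
  have iq: "indep (nbhd q)"
  proof (rule indepI)
    fix u w assume "u \<in> nbhd q" "w \<in> nbhd q" and uw: "E u w"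
    then have qu: "E q u" "E q w" unfolding nbhd_def by auto
    obtain t t' where t: "t \<in> T" "u \<in> row t" and t': "t' \<in> T" "w \<in> row t'" using nq qu by metis
    show False
    proof (cases "t = t'")
      case True
      then show False
        using one_common[OF uw, of t q] row_E[OF t(2)] row_E[OF t'(2)] qu T_M[OF t(1)] q
          E_commute[of t] E_commute[of q] by blast
    next
      case False
      obtain t'' where t'': "t'' \<in> T" "t'' \<noteq> t" "t'' \<noteq> t'" using T_third[OF t(1) t'(1)] by metis
      obtain b b' where b: "b \<in> row t''" "E q b" "b' \<in> row t''" "E b b'" using mated[OF t''(1)] by blast
      have "u \<noteq> b" "w \<noteq> b" using row_disj t t' t'' b by blast+
      then have "\<not> E u b" "\<not> E w b"
        using one_common[of q u w b] one_common[of q w u b] qu uw b E_commute[of u w] by blast+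
      then have "E u b'" "E w b'"
        using mate_dichotomy[OF t''(1) t(1) t''(2) b(1,3,4) q b(2) t(2) qu(1)]
          mate_dichotomy[OF t''(1) t'(1) t''(3) b(1,3,4) q b(2) t'(2) qu(2)] by blast+
      then have "q = b'" using one_common[OF uw, of q b'] qu E_commute[of q] by blast
      then show False using row_M[OF t''(1) b(3)] q by blast
    qed
  qed
  have far_path: "E v a \<or> E v b"
    if t: "t \<in> T" "t' \<in> T" "t'' \<in> T" "t \<noteq> t'" "t \<noteq> t''" "t' \<noteq> t''" and v: "v \<in> row t" "\<not> E q v"
      and a: "a \<in> row t'" "E q a" and b: "b \<in> row t''" "E q b" for t t' t'' v a b
  proof (rule ccontr)
    assume neg: "\<not> ?thesis"
    have "\<not> E a b" using iq a b unfolding indep_def nbhd_def by blast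
    then show False
      using P6[of v t t' a q b] neg row_E[OF v(1)] row_E[OF a(1)] T_adj[OF t(1,2,4)] v a b
        row_other[OF t(1,2,4) v(1)] row_other[OF t(2,1) _ a(1)] row_other[OF t(3,1) _ b(1)] row_other[OF t(3,2) _ b(1)]
        M_T[OF t(1) q] M_T[OF t(2) q] t E_commute[of v t] E_commute[of q v] E_commute[of v t'] E_commute[of a q] by metis
  qed
  \<comment> \<open>No vertex of another row sees \<open>t'\<close>, so the three sets also take up
    the triangle.\<close>
  define J where "J t' = {v. \<exists>t\<in>T. t \<noteq> t' \<and> v \<in> row t \<and> (\<forall>a\<in>row t'. E q a \<longrightarrow> E v a)} \<union> {t'}" for t'
  have iJ: "indep (J t')" if t': "t' \<in> T" for t'
  proof (rule indepI)
    obtain a b where ab: "a \<in> row t'" "b \<in> row t'" "a \<noteq> b" "E q a" "E q b" using two[OF t'] by blast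
    fix u v assume u: "u \<in> J t'" and v: "v \<in> J t'" and uv: "E u v"
    show False
    proof (cases "u = t' \<or> v = t'")
      case True
      then show False using row_other[of _ t'] u v uv irrE t' E_commute[of u v] unfolding J_def by blast
    next
      case False
      then have "E u a" "E u b" "E v a" "E v b" using u v ab unfolding J_def by blast+
      then show False using noadj uv ab by blast
    qed
  qed
  have "V \<subseteq> nbhd q \<union> M \<union> (J x \<union> J y \<union> J z)"
  proof
    fix v assume "v \<in> V"
    then show "v \<in> nbhd q \<union> M \<union> (J x \<union> J y \<union> J z)"
    proof (cases rule: V_cases)
      case 2 then show ?thesis unfolding J_def T by auto
    next
      case (3 t)
      show ?thesis
      proof (cases "E q v")
        case False
        obtain t' where t': "t' \<in> T" "t' \<noteq> t" using T_third[OF 3(1) 3(1)] by metis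
        obtain t'' where t'': "t'' \<in> T" "t'' \<noteq> t" "t'' \<noteq> t'" using T_third[OF 3(1) t'(1)] by metis
        have "v \<in> J t' \<or> v \<in> J t''"
        proof (rule ccontr)
          have JI: "v \<in> J r" if "t \<noteq> r" "\<forall>a\<in>row r. E q a \<longrightarrow> E v a" for r
            using that 3 unfolding J_def by auto
          assume "\<not> ?thesis"
          then obtain a b where "a \<in> row t'" "E q a" "\<not> E v a" "b \<in> row t''" "E q b" "\<not> E v b"
            using JI[of t'] JI[of t''] t'(2) t''(2) by auto
          then show False
            using far_path[OF 3(1) t'(1) t''(1) _ _ _ 3(2) False, of a b] t'(2) t''(2,3) by blast
        qed
        then show ?thesis using t'(1) t''(1) unfolding T by auto
      qed (simp add: nbhd_def)
    qed simp
  qed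
  moreover have "col (nbhd q \<union> M) 2" by (rule col_indep_Un[OF iq M_indep])
  moreover have "col (J x \<union> J y \<union> J z) (1 + 1 + 1)" by (intro col_Un col_indep iJ) (auto simp: T)
  ultimately show False
    using col_cover[of "nbhd q \<union> M" 2 "J x \<union> J y \<union> J z" "1 + 1 + 1" 6] not6 by auto
qed

theorem min_graph_triangle_False: False
proof -
  have "\<exists>W. W \<subseteq> row t \<and> indep W \<and> indep (row t - W) \<and> (\<forall>w\<in>W. \<exists>u\<in>row t. E w u)" for t
  proof -
    have m: "v = w" if "u \<in> row t" "v \<in> row t" "w \<in> row t" "E u v" "E u w" for u v w
      by (rule one_common[of t u]) (use that row_E in auto)
    show ?thesis
    proof (rule matching_split[OF row_V m, of t])
      fix W assume "W \<subseteq> row t" "indep W" "indep (row t - W)" "\<And>w. w \<in> W \<Longrightarrow> \<exists>u\<in>row t. E w u"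
      then show ?thesis by blast
    qed
  qed
  then obtain W where W: "\<And>t. W t \<subseteq> row t" "\<And>t. indep (W t)" "\<And>t. indep (row t - W t)"
      "\<And>t w. w \<in> W t \<Longrightarrow> \<exists>u\<in>row t. E w u"
    by metis
  define P where "P t = {q\<in>M. \<forall>w\<in>W t. \<not> E q w}" for t
  define P' where "P' t = {q\<in>M. \<forall>w\<in>row t - W t. \<not> E q w}" for t
  \<comment> \<open>A vertex outside all these sets sees both color classes of every row, and its
    neighbour in \<open>W t\<close> has a mate.\<close>
  have Mcov: "M \<subseteq> (\<Union>t\<in>T. P t \<union> P' t)"
  proof
    fix q assume q: "q \<in> M"
    show "q \<in> (\<Union>t\<in>T. P t \<union> P' t)"
    proof (rule ccontr)
      assume "q \<notin> (\<Union>t\<in>T. P t \<union> P' t)"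
      then have n: "\<exists>w\<in>W t. E q w" "\<exists>u\<in>row t - W t. E q u" if "t \<in> T" for t
        using that q unfolding P_def P'_def by blast+
      show False
        by (rule rich_vertex_False[OF q]) (use n W(1,4) in blast)+
    qed
  qed
  \<comment> \<open>A rotation of the triangle: \<open>t\<close> sees its own row and must join the
    classes of another one.\<close>
  have "\<exists>\<sigma>. (\<forall>t\<in>T. \<sigma> t \<in> T \<and> t \<noteq> \<sigma> t) \<and> T \<subseteq> \<sigma> ` T"
  proof -
    have "x \<noteq> y" "y \<noteq> z" "x \<noteq> z" using xyz irrE by blast+
    then show ?thesis
      unfolding T by (intro exI[of _ "\<lambda>t. if t = x then y else if t = y then z else x"]) auto
  qed
  then obtain \<sigma> where s: "\<And>t. t \<in> T \<Longrightarrow> \<sigma> t \<in> T" "\<And>t. t \<in> T \<Longrightarrow> t \<noteq> \<sigma> t" "T \<subseteq> \<sigma> ` T"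
    by blast
  define C where "C t = (W t \<union> P t \<union> {\<sigma> t}) \<union> (row t - W t \<union> P' t \<union> {\<sigma> t})" for t
  have colC: "col (C t) 2" if t: "t \<in> T" for t
    unfolding C_def
    by (intro col_indep_Un row_class_indep[OF t s(1)[OF t] s(2)[OF t]])
      (use W in \<open>auto simp: P_def P'_def\<close>)
  have "col (C x \<union> C y \<union> C z) (2 + 2 + 2)" by (intro col_Un colC) (auto simp: T)
  moreover have "V \<subseteq> C x \<union> C y \<union> C z"
  proof -
    have "V \<subseteq> (\<Union>t\<in>T. C t)"
      using V_cover Mcov s(3) unfolding C_def by blast
    then show ?thesis unfolding T by auto
  qed
  ultimately have "col V 6" by (rule col_mono) simp
  then show False using not6 by simp
qed

end

section \<open>Conclusion of the upper bound\<close>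

lemma (in min_graph) min_graph_False: False
proof -
  obtain x y z where "E x y" "E y z" "E x z" using triangle_exists by blast
  then interpret min_graph_triangle V E x y z "{x, y, z}" "V - nbhd x - nbhd y - nbhd z"
    by unfold_locales auto
  show False by (rule min_graph_triangle_False)
qed

lemma (in free_graph) col6: "col V 6"
proof (rule ccontr)
  assume n: "\<not> col V 6"
  obtain A where A: "A \<subseteq> V" "\<not> col A 6" and least: "\<And>B. B \<subseteq> V \<Longrightarrow> \<not> col B 6 \<Longrightarrow> card A \<le> card B"
    using ex_has_least_nat[of "\<lambda>A. A \<subseteq> V \<and> \<not> col A 6" V card] n by auto
  have A_min: "col B 6" if "B \<subset> A" for B
  proof (rule ccontr)
    assume "\<not> col B 6"
    then have "card A \<le> card B" using least[of B] that A(1) by auto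
    moreover have "card B < card A"
      using psubset_card_mono[OF finite_subset[OF A(1) finV] that] .
    ultimately show False by simp
  qed
  \<comment> \<open>The locale wants edges to stay within the vertex set, so adjacency is restricted
    along with it.\<close>
  define E' where "E' u v \<longleftrightarrow> E u v \<and> u \<in> A \<and> v \<in> A" for u v
  interpret H: free_graph A E'
  proof
    show "finite A" using A finV finite_subset by blast
    show "E' v u" if "E' u v" for u v using that symE unfolding E'_def by blast
    show "\<not> E' u u" for u using irrE unfolding E'_def by blast
    show "u \<in> A" if "E' u v" for u v using that unfolding E'_def by blast
    show False if "E' a b" "E' b c" "E' c d" "E' d e" "E' e f" "\<not> E' a c" "\<not> E' a d" "\<not> E' a e" "\<not> E' a f"
      "\<not> E' b d" "\<not> E' b e" "\<not> E' b f" "\<not> E' c e" "\<not> E' c f" "\<not> E' d f" for a b c d e f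
      using P6[of a b c d e f] that unfolding E'_def by blast
    show False if "E' a b" "E' a c" "E' a d" "E' b c" "E' b d" "\<not> E' c d" "c \<noteq> d" "E' a e" "\<not> E' e b" "\<not> E' e c" "\<not> E' e d"
      for a b c d e using dart[of a b c d e] that unfolding E'_def by blast
    show False if "E' a b" "E' a c" "E' a d" "E' b c" "E' b d" "E' c d" for a b c d
      using K4[of a b c d] that unfolding E'_def by blast
  qed
  have eq: "H.col B k \<longleftrightarrow> col B k" if "B \<subseteq> A" for B k
    using that unfolding H.col_def col_def E'_def by blast
  interpret H: min_graph A E'
  proof
    show "\<not> H.col A 6" using A(2) eq by blast
    show "H.col B 6" if "B \<subset> A" for B using A_min[OF that] eq that by blast
  qed
  show False by (rule H.min_graph_False)
qed

section \<open>Induced subgraphs as forbidden configurations\<close>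

lemma wf_graph_of_edges:
  assumes "E \<subseteq> X \<times> X"
  shows "pair_wf_digraph (graph_of_edges X E)"
  using assms by unfold_locales (auto simp: graph_of_edges_def)

lemma path_graph_6: "path_graph 6 = graph_of_edges {0, 1, 2, 3, 4, 5} {(0, 1), (1, 2), (2, 3), (3, 4), (4, 5)}"
proof -
  have "{..<6::nat} = {0, 1, 2, 3, 4, 5}" by auto
  moreover have "{(i, Suc i) | i. Suc i < 6} = {(0, 1), (1, 2), (2, 3), (3, 4), (4, 5::nat)}"
    by (auto simp: less_Suc_eq numeral_eq_Suc)
  ultimately show ?thesis unfolding path_graph_def by simp
qed

lemma complete_graph_4: "complete_graph 4 = graph_of_edges {0, 1, 2, 3} {(0, 1), (0, 2), (0, 3), (1, 2), (1, 3), (2, 3)}"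
proof -
  have "{..<4::nat} = {0, 1, 2, 3}" by auto
  moreover have "{(i, j). i < j \<and> j < 4} = {(0, 1), (0, 2), (0, 3), (1, 2), (1, 3), (2, 3::nat)}"
    by (auto simp: less_Suc_eq numeral_eq_Suc)
  ultimately show ?thesis unfolding complete_graph_def by simp
qed

text \<open>Listing the image vertices turns the embedding condition into bounded quantifiers that
  the simplifier can unroll.\<close>

lemma contains_induced_nth:
  assumes G: "pair_wf_digraph G" and E: "E \<subseteq> X \<times> X" and X: "X = {..<length xs}"
    and xs: "distinct xs" "set xs \<subseteq> pverts G"
    and arcs: "\<forall>i<length xs. \<forall>j<length xs. (xs ! i, xs ! j) \<in> parcs G \<longleftrightarrow> (i, j) \<in> E \<union> E\<inverse>"
  shows "contains_induced G (graph_of_edges X E)"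
  unfolding contains_induced_iff[OF G wf_graph_of_edges[OF E]]
proof (intro exI[of _ "\<lambda>i. xs ! i"] conjI)
  show "inj_on ((!) xs) (pverts (graph_of_edges X E))"
    using xs(1) unfolding graph_of_edges_def X by (auto simp: inj_on_def nth_eq_iff_index_eq)
  show "(!) xs ` pverts (graph_of_edges X E) \<subseteq> pverts G"
    using xs(2) unfolding graph_of_edges_def X by auto
  show "\<forall>u\<in>pverts (graph_of_edges X E). \<forall>v\<in>pverts (graph_of_edges X E).
      ((xs ! u, xs ! v) \<in> parcs G) = ((u, v) \<in> parcs (graph_of_edges X E))"
    using arcs unfolding graph_of_edges_def X by auto
qed

lemma contains_induced_embedding:
  assumes "pair_wf_digraph G" "E \<subseteq> X \<times> X" "contains_induced G (graph_of_edges X E)"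
  obtains f where "inj_on f X" "\<forall>u\<in>X. \<forall>v\<in>X. (f u, f v) \<in> parcs G \<longleftrightarrow> (u, v) \<in> E \<union> E\<inverse>"
proof -
  have "\<exists>f. inj_on f X \<and> (\<forall>u\<in>X. \<forall>v\<in>X. (f u, f v) \<in> parcs G \<longleftrightarrow> (u, v) \<in> E \<union> E\<inverse>)"
    using assms(3) unfolding contains_induced_iff[OF assms(1) wf_graph_of_edges[OF assms(2)]]
    by (simp add: graph_of_edges_def) blast
  then show thesis using that by blast
qed

lemma (in pair_graph) arcs_commute: "(u, v) \<in> parcs G \<longleftrightarrow> (v, u) \<in> parcs G"
  using pair_sym_arcs unfolding symmetric_def sym_def by auto

lemma free_graph_of_pair_graph:
  fixes G :: "'a pair_pre_digraph"
  assumes G: "pair_graph G" and free: "P6_dart_K4_free G"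
  shows "free_graph (pverts G) (\<lambda>u v. (u, v) \<in> parcs G)"
proof -
  interpret G: pair_graph G by fact
  have wf: "pair_wf_digraph G" by unfold_locales
  let ?E = "\<lambda>u v. (u, v) \<in> parcs G"
  have irr: "\<not> ?E u u" for u using G.pair_no_loops by force
  have sy: "?E u v \<Longrightarrow> ?E v u" and nsy: "\<not> ?E u v \<Longrightarrow> \<not> ?E v u" for u v
    using G.arcs_commute by blast+
  have V: "u \<in> pverts G" "v \<in> pverts G" if "?E u v" for u v
    using G.in_arcsD1[OF that] G.in_arcsD2[OF that] by auto
  show ?thesis
  proof
    show "finite (pverts G)" by (rule G.pair_finite_verts)
    show "?E v u" if "?E u v" for u v using that G.arcs_commute by blast
    show "\<not> ?E u u" for u by (rule irr)
    show "u \<in> pverts G" if "?E u v" for u v using V that by blast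
  next
    fix a b c d e f
    assume e: "?E a b" "?E b c" "?E c d" "?E d e" "?E e f" "\<not> ?E a c" "\<not> ?E a d" "\<not> ?E a e" "\<not> ?E a f"
      "\<not> ?E b d" "\<not> ?E b e" "\<not> ?E b f" "\<not> ?E c e" "\<not> ?E c f" "\<not> ?E d f"
    note e' = e(1-5)[THEN sy] e(6-15)[THEN nsy]
    have "contains_induced G (path_graph 6)"
      unfolding path_graph_6
    proof (rule contains_induced_nth[OF wf, where xs = "[a, b, c, d, e, f]"])
      show "distinct [a, b, c, d, e, f]" using e e' irr by auto
      show "set [a, b, c, d, e, f] \<subseteq> pverts G" using V e by auto
      show "\<forall>i<length [a, b, c, d, e, f]. \<forall>j<length [a, b, c, d, e, f].
        ([a, b, c, d, e, f] ! i, [a, b, c, d, e, f] ! j) \<in> parcs G \<longleftrightarrow>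
        (i, j) \<in> {(0, 1), (1, 2), (2, 3), (3, 4), (4, 5)} \<union> {(0, 1), (1, 2), (2, 3), (3, 4), (4, 5)}\<inverse>"
        using e e' irr by (simp add: All_less_Suc numeral_eq_Suc)
    qed auto
    then show False using free unfolding P6_dart_K4_free_def by blast
  next
    fix a b c d e
    assume e: "?E a b" "?E a c" "?E a d" "?E b c" "?E b d" "\<not> ?E c d" "c \<noteq> d" "?E a e" "\<not> ?E e b" "\<not> ?E e c" "\<not> ?E e d"
    note e' = e(1-5,8)[THEN sy] e(6,9-11)[THEN nsy]
    have "contains_induced G dart"
      unfolding dart_explicit
    proof (rule contains_induced_nth[OF wf, where xs = "[a, b, c, d, e]"])
      show "distinct [a, b, c, d, e]" using e e' irr by auto
      show "set [a, b, c, d, e] \<subseteq> pverts G" using V e by auto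
      show "\<forall>i<length [a, b, c, d, e]. \<forall>j<length [a, b, c, d, e].
        ([a, b, c, d, e] ! i, [a, b, c, d, e] ! j) \<in> parcs G \<longleftrightarrow>
        (i, j) \<in> {(0, 1), (0, 2), (0, 3), (1, 2), (1, 3), (0, 4)} \<union> {(0, 1), (0, 2), (0, 3), (1, 2), (1, 3), (0, 4)}\<inverse>"
        using e e' irr by (simp add: All_less_Suc numeral_eq_Suc)
    qed auto
    then show False using free unfolding P6_dart_K4_free_def by blast
  next
    fix a b c d
    assume e: "?E a b" "?E a c" "?E a d" "?E b c" "?E b d" "?E c d"
    note e' = e[THEN sy]
    have "contains_induced G (complete_graph 4)"
      unfolding complete_graph_4
    proof (rule contains_induced_nth[OF wf, where xs = "[a, b, c, d]"])
      show "distinct [a, b, c, d]" using e irr by auto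
      show "set [a, b, c, d] \<subseteq> pverts G" using V e by auto
      show "\<forall>i<length [a, b, c, d]. \<forall>j<length [a, b, c, d].
        ([a, b, c, d] ! i, [a, b, c, d] ! j) \<in> parcs G \<longleftrightarrow>
        (i, j) \<in> {(0, 1), (0, 2), (0, 3), (1, 2), (1, 3), (2, 3)} \<union> {(0, 1), (0, 2), (0, 3), (1, 2), (1, 3), (2, 3)}\<inverse>"
        using e e' irr by (simp add: All_less_Suc numeral_eq_Suc)
    qed auto
    then show False using free unfolding P6_dart_K4_free_def by blast
  qed
qed

lemma colorable_6:
  assumes "pair_graph G" "P6_dart_K4_free G"
  shows "colorable G 6"
proof -
  interpret free_graph "pverts G" "\<lambda>u v. (u, v) \<in> parcs G"
    by (rule free_graph_of_pair_graph[OF assms])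
  interpret G: pair_graph G by fact
  obtain c :: "'a \<Rightarrow> nat" where "\<And>v. v \<in> pverts G \<Longrightarrow> c v < 6"
    "\<And>u v. u \<in> pverts G \<Longrightarrow> v \<in> pverts G \<Longrightarrow> (u, v) \<in> parcs G \<Longrightarrow> c u \<noteq> c v"
    using colE[OF col6] by metis
  then have "proper_coloring G 6 c"
    unfolding proper_coloring_def using G.in_arcsD1 G.in_arcsD2 by blast
  then show ?thesis unfolding colorable_def by blast
qed

section \<open>The complement of the Schlaefli graph\<close>

text \<open>The collinearity graph of the Ahrens-Szekeres model of the generalized quadrangle of order (2, 4),
  whose points are those of the affine space of dimension 3 over the field with three elements;
  \<open>x + 3 y + 9 z\<close> encodes the point \<open>(x, y, z)\<close>. Points with \<open>z \<noteq> z'\<close> are collinear if and only if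
  \<open>x - x' = (z - z') (y + y')\<close>, where \<open>-1\<close> is written as \<open>2\<close> below to avoid truncated subtraction.\<close>

definition sadj :: "nat \<Rightarrow> nat \<Rightarrow> bool" where
  "sadj i j \<longleftrightarrow> (let x = i mod 3; y = i div 3 mod 3; z = i div 9; x' = j mod 3; y' = j div 3 mod 3; z' = j div 9 in
    if z = z' then (x = x') \<noteq> (y = y') else (x + 2 * x' + (2 * z + z') * (y + y')) mod 3 = 0)"

definition schlaefli_co :: "nat pair_pre_digraph" where
  "schlaefli_co = \<lparr>pverts = {..<27}, parcs = {(i, j). i < 27 \<and> j < 27 \<and> sadj i j}\<rparr>"

lemma sadj_sym: "sadj i j \<Longrightarrow> sadj j i"
proof -
  have "(b + 2 * a + (2 * d + c) * (f + e)) mod 3 = 0" if "(a + 2 * b + (2 * c + d) * (e + f)) mod 3 = 0" for a b c d e f :: nat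
  proof -
    \<comment> \<open>The two expressions add up to a multiple of 3, so they vanish modulo 3
      together.\<close>
    have "(b + 2 * a + (2 * d + c) * (f + e)) + (a + 2 * b + (2 * c + d) * (e + f)) = 3 * (a + b + (c + d) * (e + f))"
      by (simp add: algebra_simps)
    then show ?thesis using that by presburger
  qed
  then show "sadj i j \<Longrightarrow> sadj j i"
    unfolding sadj_def Let_def by (auto split: if_splits)
qed

lemma pair_graph_schlaefli_co: "pair_graph schlaefli_co"
proof
  show "finite (pverts schlaefli_co)" "finite (parcs schlaefli_co)"
    unfolding schlaefli_co_def by (auto intro: finite_subset[of _ "{..<27} \<times> {..<27}"])
  show "symmetric (with_proj schlaefli_co)"
    using sadj_sym unfolding symmetric_def schlaefli_co_def sym_def by auto
qed (auto simp: schlaefli_co_def sadj_def)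

definition adjacency_rows :: "bool list list" where
  "adjacency_rows = map (\<lambda>i. map (sadj i) [0..<27]) [0..<27]"

\<comment> \<open>Stores the table as a literal, so that the check below works on Booleans
  only.\<close>
schematic_goal adjacency_rows_eval: "adjacency_rows = ?rows"
  unfolding adjacency_rows_def by code_simp

section \<open>Lines of the quadrangle, checked by evaluation\<close>

fun exactly_one :: "bool list \<Rightarrow> bool" where
  "exactly_one [] = False"
| "exactly_one (True # bs) = list_all Not bs"
| "exactly_one (False # bs) = exactly_one bs"

text \<open>If row \<open>r\<close> and row \<open>r'\<close> have a unique common neighbour, \<open>select\<close> finds its row of the adjacency matrix.\<close>

fun select :: "bool list \<Rightarrow> 'b list list \<Rightarrow> 'b list" where
  "select (True # bs) (r # rs) = r"
| "select (False # bs) (r # rs) = select bs rs"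
| "select bs rs = []"

fun dominated :: "bool list \<Rightarrow> bool list \<Rightarrow> bool list \<Rightarrow> bool" where
  "dominated (a # as) (b # bs) (c # cs) \<longleftrightarrow> (a \<or> b \<or> c) \<and> dominated as bs cs"
| "dominated as bs cs \<longleftrightarrow> True"

text \<open>For collinear points with rows \<open>r\<close> and \<open>r'\<close>, the unique common
  neighbour is the third point of their line; that every point is collinear with some point of the
  line comes from the quadrangle axiom.\<close>

definition line_check :: "bool list list \<Rightarrow> bool list \<Rightarrow> bool list \<Rightarrow> bool" where
  "line_check rs r r' \<longleftrightarrow>
     (let m = map2 (\<and>) r r' in exactly_one m \<and> dominated r r' (select m rs))"

lemma exactly_one_nth:
  "exactly_one bs \<Longrightarrow> length rs = length bs \<Longrightarrow>
    \<exists>k<length bs. (\<forall>d<length bs. bs ! d \<longleftrightarrow> d = k) \<and> select bs rs = rs ! k"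
proof (induction bs arbitrary: rs rule: exactly_one.induct)
  case (2 bs)
  obtain r rs' where "rs = r # rs'" using 2 by (cases rs) auto
  moreover have "(True # bs) ! d \<longleftrightarrow> d = 0" if "d < length (True # bs)" for d
    using 2 that by (cases d) (auto simp: list_all_length)
  ultimately show ?case by (intro exI[of _ 0]) (simp del: nth_Cons_0 length_Cons, simp)
next
  case (3 bs)
  obtain r rs' where rs: "rs = r # rs'" "length rs' = length bs" using 3 by (cases rs) auto
  then obtain k where k: "k < length bs" "\<forall>d<length bs. bs ! d \<longleftrightarrow> d = k" "select bs rs' = rs' ! k"
    using 3 by auto
  have "(False # bs) ! d \<longleftrightarrow> d = Suc k" if "d < length (False # bs)" for d
    using k that by (cases d) auto
  then show ?case using k rs by (intro exI[of _ "Suc k"]) auto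
qed simp

lemma dominated_nth:
  "dominated as bs cs \<Longrightarrow> d < length as \<Longrightarrow> d < length bs \<Longrightarrow> d < length cs \<Longrightarrow> as ! d \<or> bs ! d \<or> cs ! d"
proof (induction as bs cs arbitrary: d rule: dominated.induct)
  case (1 a as b bs c cs)
  then show ?case by (cases d) auto
qed auto

lemma adjacency_rows_check:
  "list_all (\<lambda>r. list_all (\<lambda>(b, r'). b \<longrightarrow> line_check adjacency_rows r r') (zip r adjacency_rows)) adjacency_rows"
  unfolding adjacency_rows_eval by code_simp

lemma sadj_line:
  assumes "i < 27" "j < 27" "sadj i j"
  shows "\<exists>k<27. \<forall>d<27. (sadj i d \<and> sadj j d \<longleftrightarrow> d = k) \<and> (sadj i d \<or> sadj j d \<or> sadj k d)"
proof -
  let ?R = adjacency_rows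
  have len: "length ?R = 27" and row: "\<And>i. i < 27 \<Longrightarrow> ?R ! i = map (sadj i) [0..<27]"
    unfolding adjacency_rows_def by auto
  have "list_all (\<lambda>(b, r'). b \<longrightarrow> line_check ?R (?R ! i) r') (zip (?R ! i) ?R)"
    using adjacency_rows_check assms(1) len by (auto simp: list_all_length)
  then have "line_check ?R (?R ! i) (?R ! j)"
    using assms len row[of i] unfolding list_all_length by (auto dest: spec[of _ j])
  then have chk: "exactly_one (map2 (\<and>) (?R ! i) (?R ! j))"
      "dominated (?R ! i) (?R ! j) (select (map2 (\<and>) (?R ! i) (?R ! j)) ?R)"
    unfolding line_check_def Let_def by auto
  have lm: "length (map2 (\<and>) (?R ! i) (?R ! j)) = 27" using assms row by simp
  obtain k where k: "k < 27" "\<forall>d<27. map2 (\<and>) (?R ! i) (?R ! j) ! d \<longleftrightarrow> d = k"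
      "select (map2 (\<and>) (?R ! i) (?R ! j)) ?R = ?R ! k"
    using exactly_one_nth[OF chk(1), of ?R] lm len by auto
  have "(sadj i d \<and> sadj j d \<longleftrightarrow> d = k) \<and> (sadj i d \<or> sadj j d \<or> sadj k d)" if "d < 27" for d
    using k dominated_nth[OF chk(2), of d] that assms row by auto
  then show ?thesis using k(1) by blast
qed

lemma schlaefli_co_no_diamond:
  assumes "(a, b) \<in> parcs schlaefli_co" "(a, c) \<in> parcs schlaefli_co" "(b, c) \<in> parcs schlaefli_co"
    "(a, d) \<in> parcs schlaefli_co" "(b, d) \<in> parcs schlaefli_co"
  shows "c = d"
proof -
  have ab: "a < 27" "b < 27" "sadj a b" and cd: "c < 27" "d < 27" "sadj a c \<and> sadj b c" "sadj a d \<and> sadj b d"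
    using assms unfolding schlaefli_co_def by auto
  obtain k where k: "\<forall>v<27. (sadj a v \<and> sadj b v \<longleftrightarrow> v = k)"
    using sadj_line[OF ab] by blast
  show ?thesis using k cd by blast
qed

text \<open>The third point of the line through \<open>a\<close> and \<open>b\<close> must see
  \<open>d\<close>, \<open>e\<close> and \<open>f\<close>, and then shares both \<open>d\<close> and
  \<open>f\<close> with \<open>e\<close>. An induced P6 contains such an edge and P3 at its two
  ends.\<close>

lemma schlaefli_co_no_far_P3:
  assumes ab: "(a, b) \<in> parcs schlaefli_co" and de: "(d, e) \<in> parcs schlaefli_co" and ef: "(e, f) \<in> parcs schlaefli_co"
    and "d \<noteq> f" and far: "\<And>v. v \<in> {d, e, f} \<Longrightarrow> (a, v) \<notin> parcs schlaefli_co \<and> (b, v) \<notin> parcs schlaefli_co"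
  shows False
proof -
  have lt: "a < 27" "b < 27" "d < 27" "e < 27" "f < 27" "sadj a b"
    using ab de ef unfolding schlaefli_co_def by auto
  obtain k where k: "k < 27" "\<forall>v<27. sadj a v \<or> sadj b v \<or> sadj k v"
    using sadj_line[OF lt(1,2,6)] by blast
  have "(k, v) \<in> parcs schlaefli_co" if "v \<in> {d, e, f}" for v
    using k far[OF that] that lt unfolding schlaefli_co_def by auto
  moreover have "(e, d) \<in> parcs schlaefli_co" using de sadj_sym unfolding schlaefli_co_def by auto
  ultimately show False using schlaefli_co_no_diamond[of k e d f] ef \<open>d \<noteq> f\<close> by auto
qed

lemma schlaefli_co_free: "P6_dart_K4_free schlaefli_co"
proof -
  interpret pair_graph schlaefli_co by (rule pair_graph_schlaefli_co)
  have wf: "pair_wf_digraph schlaefli_co" by unfold_locales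
  \<comment> \<open>The dart and K4 both contain these five edges; whether 2 and 3 are adjacent does
    not matter for having two common neighbours.\<close>
  have no_diamond: "\<not> contains_induced schlaefli_co (graph_of_edges X E)"
    if E: "E \<subseteq> X \<times> X" "{(0, 1), (0, 2), (0, 3), (1, 2), (1, 3)} \<subseteq> E" for X :: "nat set" and E
  proof
    assume "contains_induced schlaefli_co (graph_of_edges X E)"
    then obtain f where f: "inj_on f X" "\<forall>u\<in>X. \<forall>v\<in>X. (f u, f v) \<in> parcs schlaefli_co \<longleftrightarrow> (u, v) \<in> E \<union> E\<inverse>"
      by (rule contains_induced_embedding[OF wf E(1)])
    have X: "0 \<in> X" "1 \<in> X" "2 \<in> X" "3 \<in> X" using E by auto
    have "f 2 = f 3"
      by (rule schlaefli_co_no_diamond[of "f 0" "f 1"]) (use f(2) X E(2) in auto)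
    then show False using f(1) X by (auto dest: inj_onD)
  qed
  have "\<not> contains_induced schlaefli_co (path_graph 6)"
  proof
    have E: "{(0, 1), (1, 2), (2, 3), (3, 4), (4, 5)} \<subseteq> {0, 1, 2, 3, 4, 5} \<times> {0, 1, 2, 3, 4, 5::nat}" by auto
    assume "contains_induced schlaefli_co (path_graph 6)"
    then obtain f :: "nat \<Rightarrow> nat" where f: "inj_on f {0, 1, 2, 3, 4, 5}"
      "\<forall>u\<in>{0, 1, 2, 3, 4, 5}. \<forall>v\<in>{0, 1, 2, 3, 4, 5}. (f u, f v) \<in> parcs schlaefli_co \<longleftrightarrow>
        (u, v) \<in> {(0, 1), (1, 2), (2, 3), (3, 4), (4, 5)} \<union> {(0, 1), (1, 2), (2, 3), (3, 4), (4, 5)}\<inverse>"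
      unfolding path_graph_6 by (rule contains_induced_embedding[OF wf E])
    have "f 3 \<noteq> f 5" using f(1) by (auto dest: inj_onD)
    then show False
      by (intro schlaefli_co_no_far_P3[of "f 0" "f 1" "f 3" "f 4" "f 5"]) (use f(2) in auto)
  qed
  moreover have "\<not> contains_induced schlaefli_co dart"
    unfolding dart_explicit by (rule no_diamond) auto
  moreover have "\<not> contains_induced schlaefli_co (complete_graph 4)"
    unfolding complete_graph_4 by (rule no_diamond) auto
  ultimately show ?thesis unfolding P6_dart_K4_free_def by blast
qed

section \<open>Five colors do not suffice\<close>

definition edge_list :: "(nat \<times> nat) list" where
  "edge_list = [(i, j). i \<leftarrow> [0..<27], j \<leftarrow> [0..<27], j < i \<and> sadj i j]"

lemma upt_27: "[0..<27] = [0, 1, 2, 3, 4, 5, 6, 7, 8, 9, 10, 11, 12, 13, 14, 15, 16, 17, 18, 19, 20, 21, 22, 23, 24, 25, 26]"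
  by code_simp

schematic_goal edge_list_eval: "edge_list = ?es"
  unfolding edge_list_def by code_simp

text \<open>The classes 0, 1, 2 are named after the triangle on the vertices 0, 1, 2, which breaks the symmetry
  between the colors.\<close>

lemma no_five_classes:
  fixes P :: "nat \<Rightarrow> nat \<Rightarrow> bool"
  assumes "P 0 0" "P 1 1" "P 2 2"
    and "\<forall>i\<in>set [0..<27]. P i 0 \<or> P i 1 \<or> P i 2 \<or> P i 3 \<or> P i 4"
    and "\<forall>(i, j)\<in>set edge_list. \<not> (P i 0 \<and> P j 0) \<and> \<not> (P i 1 \<and> P j 1) \<and> \<not> (P i 2 \<and> P j 2) \<and>
      \<not> (P i 3 \<and> P j 3) \<and> \<not> (P i 4 \<and> P j 4)"
  shows False
  using assms(1-3) assms(4)[unfolded upt_27 list.set ball_simps]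
    assms(5)[unfolded edge_list_eval list.set ball_simps prod.case]
  by sat

lemma schlaefli_co_not_colorable_5: "\<not> colorable schlaefli_co 5"
proof
  assume "colorable schlaefli_co 5"
  then obtain c :: "nat \<Rightarrow> nat" where c5: "\<And>i. i < 27 \<Longrightarrow> c i < 5" and c: "\<And>i j. i < 27 \<Longrightarrow> j < 27 \<Longrightarrow> sadj i j \<Longrightarrow> c i \<noteq> c j"
    unfolding colorable_def proper_coloring_def schlaefli_co_def by auto
  have "c 0 \<noteq> c 1" "c 0 \<noteq> c 2" "c 1 \<noteq> c 2" by (rule c; simp add: sadj_def)+
  moreover have "c 0 < 5" "c 1 < 5" "c 2 < 5" by (simp_all add: c5)
  ultimately have "card ({..<5} - {c 0, c 1, c 2}) = 2"
    by (subst card_Diff_subset) auto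
  \<comment> \<open>The two colors that the triangle 0, 1, 2 leaves over become classes 3 and
    4.\<close>
  then obtain p q where pq: "{..<5} - {c 0, c 1, c 2} = {p, q}"
    by (auto simp: card_2_iff)
  define P where "P i k \<longleftrightarrow> c i = [c 0, c 1, c 2, p, q] ! k" for i k
  show False
  proof (rule no_five_classes[of P])
    show "P 0 0" "P 1 1" "P 2 2" unfolding P_def by simp_all
    show "\<forall>i\<in>set [0..<27]. P i 0 \<or> P i 1 \<or> P i 2 \<or> P i 3 \<or> P i 4"
    proof
      fix i assume "i \<in> set [0..<27::nat]"
      then have "c i \<in> {..<5}" using c5 by simp
      then have "c i \<in> {c 0, c 1, c 2} \<union> {p, q}" using pq by blast
      then show "P i 0 \<or> P i 1 \<or> P i 2 \<or> P i 3 \<or> P i 4" unfolding P_def by auto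
    qed
    have "c i \<noteq> c j" if "(i, j) \<in> set edge_list" for i j
      using that c unfolding edge_list_def by auto
    then show "\<forall>(i, j)\<in>set edge_list. \<not> (P i 0 \<and> P j 0) \<and> \<not> (P i 1 \<and> P j 1) \<and> \<not> (P i 2 \<and> P j 2) \<and>
      \<not> (P i 3 \<and> P j 3) \<and> \<not> (P i 4 \<and> P j 4)"
      unfolding P_def by fastforce
  qed
qed

theorem theorem1p4:
  shows "(\<forall>G :: 'a pair_pre_digraph.
            pair_graph G \<and> P6_dart_K4_free G \<longrightarrow> colorable G 6 \<and> chromatic_number G \<le> 6)
       \<and> (\<exists>G :: nat pair_pre_digraph.
            pair_graph G \<and> P6_dart_K4_free G \<and> chromatic_number G = 6)"
proof (intro conjI allI impI)
  fix G :: "'a pair_pre_digraph"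
  assume G: "pair_graph G \<and> P6_dart_K4_free G"
  then show "colorable G 6" using colorable_6 by blast
  then show "chromatic_number G \<le> 6" using chromatic_number_le_iff G by blast
next
  have "chromatic_number schlaefli_co \<le> 6" "\<not> chromatic_number schlaefli_co \<le> 5"
    using colorable_6[OF pair_graph_schlaefli_co schlaefli_co_free] schlaefli_co_not_colorable_5
      chromatic_number_le_iff[OF pair_graph_schlaefli_co] by auto
  then have "chromatic_number schlaefli_co = 6" by simp
  then show "\<exists>G :: nat pair_pre_digraph. pair_graph G \<and> P6_dart_K4_free G \<and> chromatic_number G = 6"
    using pair_graph_schlaefli_co schlaefli_co_free by blast
qed

end
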